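(* Consider the problem $\min_{x\in\mathbb{R}^N} g(x)+F(x)$, $F=\frac1n\sum_{i=1}^n f_i$, under the Problem Properties assumption, with unique solution $x^\star$. Let $\bar L=\frac1n\sum_{i=1}^nL_i$ and $D_L=4-3\frac{\mu}{\bar L}$. Run L-SVRG (see context) with expected update frequency $\eta\in(0,1]$, Lipschitz sampling $p_i=L_i/\sum_jL_j$, and step-size $$\lambda=\frac{2}{D_L\bar L+\eta^{-1}\mu+\sqrt{(D_L\bar L)^2+(\eta^{-1}\mu)^2}}.$$ Assume the computational cost of one iteration is, in expectation, $1+n\eta$ gradient evaluations (one for the primal update and $n\eta$ for the dual update). Then L-SVRG achieves an $\epsilon$-accurate solution, i.e. $\mathbb{E}\|x^k-x^\star\|^2\le\epsilon$, with computational complexity (expected number of gradient evaluations) $$\mathcal{O}\Big((1+n\eta)\Big(D_L\frac{\bar L}{\mu}+\frac1\eta\Big)\log\frac1\epsilon\Big).$$ The expected update frequency that minimizes this complexity expression, and the corresponding complexity, are $$\eta^\star=\sqrt{\frac{\mu}{nD_L\bar L}}\qquad\text{and}\qquad \mathcal{O}\Big(\Big(\sqrt n+\sqrt{D_L\tfrac{\bar L}{\mu}}\Big)^2\log\frac1\epsilon\Big).$$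
   Context: Problem Properties: $g:\mathbb{R}^N\to\mathbb{R}\cup\{\infty\}$ is closed, convex and proper. For every $i\in\{1,\dots,n\}$, $f_i:\mathbb{R}^N\to\mathbb{R}$ is convex, differentiable and $L_i$-smooth. $F=\frac1n\sum_{i=1}^n f_i$ is $\mu$-strongly convex, differentiable and $L$-smooth with $L\le\frac1n\sum_{i=1}^nL_i$. Here a convex $f$ is $L$-smooth ($L>0$) if it is differentiable and $\langle\nabla f(x)-\nabla f(y),x-y\rangle\ge\frac1L\|\nabla f(x)-\nabla f(y)\|^2$ for all $x,y$ (equivalently, $\nabla f$ is $L$-Lipschitz), and $f$ is $\mu$-strongly convex ($\mu>0$) if $f-\frac\mu2\|\cdot\|^2$ is convex. The norm is Euclidean, and $\operatorname{prox}_{\lambda g}(z)=\arg\min_x \lambda g(x)+\frac12\|x-z\|^2$. L-SVRG algorithm: given $x^0\in\mathbb{R}^N$, initial dual points $y_i^0=\nabla f_i(\hat x)$ ($i=1,\dots,n$) for some common $\hat x\in\mathbb{R}^N$, a step-size $\lambda>0$ and $\eta\in(0,1]$, for $k=0,1,\dots$ sample $I^k\in\{1,\dots,n\}$ with $P(I^k=i)=p_i>0$ and $Q^k$ independently and uniformly from $[0,1]$ (samples independent and identically distributed over $k$), and set $$z^{k+1}=x^k-\tfrac{\lambda}{n}\Big(\tfrac1{p_{I^k}}(\nabla f_{I^k}(x^k)-y_{I^k}^k)+\sum_{i=1}^ny_i^k\Big),\quad x^{k+1}=\operatorname{prox}_{\lambda g}(z^{k+1}),$$ and, for all $i$, $y_i^{k+1}=\nabla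 f_i(x^k)$ if $Q^k<\eta$ and $y_i^{k+1}=y_i^k$ otherwise. The complexity $\mathcal{O}(\cdot)$ is asymptotic as $\epsilon\to0$: the implied constant is absolute, and the bound holds for all $\epsilon$ below a threshold that may depend on the problem, $\eta$ and the initial points. *)

theory Defs
  imports "HOL-Probability.Probability"
begin

text \<open>The space R^N is rendered as an arbitrary Euclidean space. Functions indexed by
  1,...,n are functions on \<^typ>\<open>nat\<close> that are only used on \<^term>\<open>{1..n}\<close>.\<close>

definition gradient :: "('a::real_inner \<Rightarrow> real) \<Rightarrow> 'a \<Rightarrow> 'a" where
  "gradient f x = (THE D. GDERIV f x :> D)"

definition smooth :: "real \<Rightarrow> ('a::real_inner \<Rightarrow> real) \<Rightarrow> bool" where
  "smooth L f \<longleftrightarrow> L > 0 \<and> (\<forall>x. f differentiable (at x)) \<and>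
     (\<forall>x y. (gradient f x - gradient f y) \<bullet> (x - y)
              \<ge> 1 / L * (norm (gradient f x - gradient f y))\<^sup>2)"

definition strongly_convex :: "real \<Rightarrow> ('a::real_inner \<Rightarrow> real) \<Rightarrow> bool" where
  "strongly_convex \<mu> f \<longleftrightarrow> \<mu> > 0 \<and> convex_on UNIV (\<lambda>x. f x - \<mu> / 2 * (norm x)\<^sup>2)"

definition epigraph_ereal :: "('a \<Rightarrow> ereal) \<Rightarrow> ('a \<times> real) set" where
  "epigraph_ereal g = {(x, r). g x \<le> ereal r}"

definition closed_convex_proper :: "('a::real_inner \<Rightarrow> ereal) \<Rightarrow> bool" where
  "closed_convex_proper g \<longleftrightarrow>
     closed (epigraph_ereal g) \<and> convex (epigraph_ereal g) \<and>
     (\<forall>x. g x \<noteq> -\<infinity>) \<and> (\<exists>x. g x \<noteq> \<infinity>)"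

definition prox :: "real \<Rightarrow> ('a::real_inner \<Rightarrow> ereal) \<Rightarrow> 'a \<Rightarrow> 'a" where
  "prox lam g z =
     arg_min (\<lambda>x. ereal lam * g x + ereal (1 / 2 * (norm (x - z))\<^sup>2)) (\<lambda>_. True)"

definition finite_sum_avg :: "nat \<Rightarrow> (nat \<Rightarrow> 'a \<Rightarrow> real) \<Rightarrow> 'a \<Rightarrow> real" where
  "finite_sum_avg n f x = 1 / real n * (\<Sum>i=1..n. f i x)"

definition L_bar :: "nat \<Rightarrow> (nat \<Rightarrow> real) \<Rightarrow> real" where
  "L_bar n L = 1 / real n * (\<Sum>i=1..n. L i)"

definition D_L :: "nat \<Rightarrow> (nat \<Rightarrow> real) \<Rightarrow> real \<Rightarrow> real" where
  "D_L n L \<mu> = 4 - 3 * (\<mu> / L_bar n L)"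

definition problem_properties ::
    "nat \<Rightarrow> (nat \<Rightarrow> 'a::euclidean_space \<Rightarrow> real) \<Rightarrow> ('a \<Rightarrow> ereal) \<Rightarrow> (nat \<Rightarrow> real) \<Rightarrow> real \<Rightarrow> real \<Rightarrow> bool"
  where
  "problem_properties n f g L L\<^sub>F \<mu> \<longleftrightarrow>
     n \<ge> 1 \<and> closed_convex_proper g \<and>
     (\<forall>i\<in>{1..n}. convex_on UNIV (f i) \<and> smooth (L i) (f i)) \<and>
     strongly_convex \<mu> (finite_sum_avg n f) \<and> smooth L\<^sub>F (finite_sum_avg n f) \<and>
     L\<^sub>F \<le> L_bar n L"

definition lipschitz_sampling :: "nat \<Rightarrow> (nat \<Rightarrow> real) \<Rightarrow> nat \<Rightarrow> real" where
  "lipschitz_sampling n L i = L i / (\<Sum>j=1..n. L j)"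

definition step_size :: "nat \<Rightarrow> (nat \<Rightarrow> real) \<Rightarrow> real \<Rightarrow> real \<Rightarrow> real" where
  "step_size n L \<mu> \<eta> =
     2 / (D_L n L \<mu> * L_bar n L + inverse \<eta> * \<mu>
          + sqrt ((D_L n L \<mu> * L_bar n L)\<^sup>2 + (inverse \<eta> * \<mu>)\<^sup>2))"

fun lsvrg_step ::
    "nat \<Rightarrow> (nat \<Rightarrow> 'a::real_inner \<Rightarrow> real) \<Rightarrow> ('a \<Rightarrow> ereal) \<Rightarrow> (nat \<Rightarrow> real) \<Rightarrow> real \<Rightarrow> real
     \<Rightarrow> nat \<Rightarrow> real \<Rightarrow> 'a \<times> (nat \<Rightarrow> 'a) \<Rightarrow> 'a \<times> (nat \<Rightarrow> 'a)" where
  "lsvrg_step n f g p lam \<eta> i q (x, y) =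
     (prox lam g (x - (lam / real n) *\<^sub>R
         ((1 / p i) *\<^sub>R (gradient (f i) x - y i) + (\<Sum>j=1..n. y j))),
      \<lambda>j. if q < \<eta> then gradient (f j) x else y j)"

text \<open>Primal-dual iterate \<open>(x\<^sup>k, y\<^sup>k)\<close> for one realisation \<open>is\<close>, \<open>qs\<close> of the samples.\<close>

primrec lsvrg ::
    "nat \<Rightarrow> (nat \<Rightarrow> 'a::real_inner \<Rightarrow> real) \<Rightarrow> ('a \<Rightarrow> ereal) \<Rightarrow> (nat \<Rightarrow> real) \<Rightarrow> real \<Rightarrow> real
     \<Rightarrow> 'a \<Rightarrow> 'a \<Rightarrow> (nat \<Rightarrow> nat) \<Rightarrow> (nat \<Rightarrow> real) \<Rightarrow> nat \<Rightarrow> 'a \<times> (nat \<Rightarrow> 'a)" where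
  "lsvrg n f g p lam \<eta> x0 xhat is qs 0 = (x0, \<lambda>i. gradient (f i) xhat)"
| "lsvrg n f g p lam \<eta> x0 xhat is qs (Suc k) =
     lsvrg_step n f g p lam \<eta> (is k) (qs k) (lsvrg n f g p lam \<eta> x0 xhat is qs k)"

definition lsvrg_samples ::
    "'w measure \<Rightarrow> nat \<Rightarrow> (nat \<Rightarrow> real) \<Rightarrow> (nat \<Rightarrow> 'w \<Rightarrow> nat) \<Rightarrow> (nat \<Rightarrow> 'w \<Rightarrow> real) \<Rightarrow> bool" where
  "lsvrg_samples M n p I Q \<longleftrightarrow>
     prob_space M \<and>
     (\<forall>k. I k \<in> M \<rightarrow>\<^sub>M count_space {1..n}) \<and>
     (\<forall>k. Q k \<in> borel_measurable M) \<and>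
     (\<forall>k. \<forall>i\<in>{1..n}. measure M {\<omega> \<in> space M. I k \<omega> = i} = p i) \<and>
     (\<forall>k. distr M borel (Q k) = uniform_measure lborel {0..1}) \<and>
     (\<forall>k. prob_space.indep_var M (count_space {1..n}) (I k) borel (Q k)) \<and>
     prob_space.indep_vars M (\<lambda>_. count_space {1..n} \<Otimes>\<^sub>M borel) (\<lambda>k \<omega>. (I k \<omega>, Q k \<omega>)) UNIV"

text \<open>\<open>cost k\<close> is the random number of gradient evaluations in iteration \<open>k\<close>; only its
  expectation is prescribed. The count \<open>1 + n * of_bool (Q k < \<eta>)\<close> is an instance.\<close>

definition iteration_cost ::
    "'w measure \<Rightarrow> nat \<Rightarrow> real \<Rightarrow> (nat \<Rightarrow> 'w \<Rightarrow> real) \<Rightarrow> bool" where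
  "iteration_cost M n \<eta> cost \<longleftrightarrow>
     (\<forall>k. integrable M (cost k) \<and> integral\<^sup>L M (cost k) = 1 + real n * \<eta>)"

text \<open>The absolute constant hidden in \<open>O(\<cdot>)\<close>. It is a fixed number because an existential
  quantifier inside a theorem about a type \<open>'a\<close> would let the constant depend on \<open>'a\<close>, that is,
  on the dimension. Its value has no significance.\<close>

definition O_const :: real where
  "O_const = 100"

text \<open>L-SVRG achieves an \<open>\<epsilon>\<close>-accurate solution with complexity \<open>O(B \<epsilon>)\<close> as \<open>\<epsilon> \<rightarrow> 0\<close>. The
  threshold \<open>\<epsilon>0\<close> and the iteration count \<open>K\<close> are chosen before the probability space, so they
  depend on neither the space nor the sampled variables; \<^typ>\<open>'w itself\<close> only names the type
  over which the probability spaces range.\<close>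

definition lsvrg_complexity ::
    "'w itself \<Rightarrow> nat \<Rightarrow> (nat \<Rightarrow> 'a::euclidean_space \<Rightarrow> real) \<Rightarrow> ('a \<Rightarrow> ereal) \<Rightarrow> (nat \<Rightarrow> real)
     \<Rightarrow> real \<Rightarrow> real \<Rightarrow> 'a \<Rightarrow> 'a \<Rightarrow> 'a \<Rightarrow> (real \<Rightarrow> real) \<Rightarrow> bool" where
  "lsvrg_complexity _ n f g p lam \<eta> x0 xhat xstar B \<longleftrightarrow>
     (\<exists>\<epsilon>0>0. \<forall>\<epsilon>. 0 < \<epsilon> \<and> \<epsilon> < \<epsilon>0 \<longrightarrow> (\<exists>K.
        \<forall>(M :: 'w measure) I Q cost.
          lsvrg_samples M n p I Q \<longrightarrow> iteration_cost M n \<eta> cost \<longrightarrow>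
          (let x = (\<lambda>k \<omega>. fst (lsvrg n f g p lam \<eta> x0 xhat (\<lambda>j. I j \<omega>) (\<lambda>j. Q j \<omega>) k)) in
           (\<forall>k\<ge>K. integrable M (\<lambda>\<omega>. (norm (x k \<omega> - xstar))\<^sup>2) \<and>
                   (\<integral>\<omega>. (norm (x k \<omega> - xstar))\<^sup>2 \<partial>M) \<le> \<epsilon>) \<and>
           (\<integral>\<omega>. (\<Sum>k<K. cost k \<omega>) \<partial>M) \<le> O_const * B \<epsilon>)))"

end

theory Submission
  imports Defs
begin

text \<open>The proof is a Lyapunov argument. Write \<open>Lb\<close> for the average of the \<open>L i\<close>. The state of the
  algorithm is measured by \<open>\<parallel>x - xstar\<parallel>\<^sup>2 + (4 lam\<^sup>2 / \<eta>) V(y)\<close>, where \<open>V(y)\<close> is the variance, under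
  the sampling probabilities, of the dual errors \<open>(y\<^sub>i - \<nabla>f\<^sub>i(xstar)) / (n p\<^sub>i)\<close>.

  The minimizer is a fixed point of the proximal gradient map and the proximal operator is
  nonexpansive (\<open>prox_dist_minimizer_le\<close>), so the distance to \<open>xstar\<close> after a step is bounded by
  the distance before the proximal operator is applied. The gradient estimator is unbiased; its
  second moment around \<open>\<nabla>F(xstar)\<close> is at most \<open>(2 Lb - \<mu>) T + 2 V(y)\<close> (\<open>expected_primal_step\<close>),
  where \<open>T = (\<nabla>F(x) - \<nabla>F(xstar)) \<bullet> (x - xstar)\<close>. An update of the dual points replaces \<open>V(y)\<close> by a
  quantity that is at most \<open>(Lb - \<mu>) T\<close> (\<open>variance_gradients_le\<close>). The prescribed step size
  satisfies \<open>lam (4 Lb - 3 \<mu>) \<le> 1\<close>, so the multiples of \<open>T\<close> sum to at most \<open>- lam T / 2\<close>,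
  and \<open>T \<ge> \<mu> \<parallel>x - xstar\<parallel>\<^sup>2\<close>. The expected Lyapunov value therefore shrinks in every step by the
  factor \<open>1 - \<rho>\<close>, where \<open>2 \<rho>\<close> is the smaller of \<open>lam \<mu>\<close> and \<open>\<eta>\<close>
  (\<open>expected_lyapunov_contracts\<close>). Both are at least \<open>1 / W\<close> for \<open>W = D Lb / \<mu> + 1 / \<eta>\<close>
  (\<open>step_size_bounds\<close>).

  An iterate depends on the samples only through the finitely many values of \<open>I j\<close> and the truth
  values of \<open>Q j < \<eta>\<close>. Its expectations are thus finite sums over histories weighted by products of
  probabilities (\<open>expectation_history\<close>), and the one-step bound iterates to geometric decay
  (\<open>expected_lyapunov_le\<close>). Hence a multiple of \<open>W ln (1 / \<epsilon>)\<close> iterations is enough, each costing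
  \<open>1 + n \<eta>\<close> in expectation.

  The optimal frequency comes from the identity
  \<open>(1 + n \<eta>) (a + 1 / \<eta>) = (sqrt n + sqrt a)\<^sup>2 + (sqrt (n a) \<eta> - 1)\<^sup>2 / \<eta>\<close> with \<open>a = D Lb / \<mu>\<close>
  (\<open>update_cost_eq\<close>). It shows the minimizer \<open>1 / sqrt (n a)\<close>, its uniqueness, and the minimal
  value, so the last claim is the first one at the optimal frequency.\<close>

section \<open>Gradients and optimality\<close>

text \<open>The derivative along the segment is a limit of difference quotients from the right. Both
  the tangent inequality for convex functions and the first-order optimality condition below are
  instances, since convexity yields a bound that is linear in \<open>t\<close>.\<close>
lemma gderiv_le_of_segment:
  fixes h :: "'a::real_inner \<Rightarrow> real"
  assumes deriv: "GDERIV h x :> D"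
    and incr: "\<And>t. 0 < t \<Longrightarrow> t \<le> 1 \<Longrightarrow> t * c \<le> h (x + t *\<^sub>R d) - h x"
  shows "c \<le> D \<bullet> d"
proof -
  let ?\<phi> = "\<lambda>t. h (x + t *\<^sub>R d)"
  have line: "((\<lambda>t. x + t *\<^sub>R d) has_derivative (\<lambda>t. t *\<^sub>R d)) (at 0)"
    by (auto intro!: derivative_eq_intros)
  have "(h has_derivative (\<lambda>v. v \<bullet> D)) (at (x + 0 *\<^sub>R d))"
    using deriv by (simp add: gderiv_def)
  from has_derivative_compose[OF line this]
  have "(?\<phi> has_real_derivative (D \<bullet> d)) (at 0)"
    unfolding has_field_derivative_def
    by (rule has_derivative_eq_rhs) (auto simp: inner_commute mult.commute)
  then have "((\<lambda>t. (?\<phi> (0 + t) - ?\<phi> 0) / t) \<longlongrightarrow> D \<bullet> d) (at 0)"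
    by (simp only: DERIV_def)
  then have lim: "((\<lambda>t. (?\<phi> t - h x) / t) \<longlongrightarrow> D \<bullet> d) (at_right 0)"
    by (auto intro: filterlim_mono[OF _ order_refl at_le])
  have "\<forall>\<^sub>F t in at_right 0. t \<in> {0<..1::real}"
    by (auto simp: eventually_at_right_field intro!: exI[of _ 1])
  then have "\<forall>\<^sub>F t in at_right 0. c \<le> (?\<phi> t - h x) / t"
    by eventually_elim (use incr in \<open>auto simp: field_simps\<close>)
  then show ?thesis
    by (intro tendsto_lowerbound[OF lim]) auto
qed

lemma convex_on_above_tangent:
  fixes h :: "'a::real_inner \<Rightarrow> real"
  assumes cvx: "convex_on UNIV h" and deriv: "GDERIV h x :> D"
  shows "h x + D \<bullet> (y - x) \<le> h y"
proof -
  have "- (h y - h x) \<le> (- D) \<bullet> (y - x)"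
  proof (rule gderiv_le_of_segment[OF GDERIV_minus[OF deriv]])
    fix t :: real assume t: "0 < t" "t \<le> 1"
    have "h ((1 - t) *\<^sub>R x + t *\<^sub>R y) \<le> (1 - t) * h x + t * h y"
      using convex_onD[OF cvx] t by auto
    moreover have "(1 - t) *\<^sub>R x + t *\<^sub>R y = x + t *\<^sub>R (y - x)"
      by (simp add: algebra_simps)
    ultimately show "t * - (h y - h x) \<le> - h (x + t *\<^sub>R (y - x)) - - h x"
      by (simp add: algebra_simps)
  qed
  then show ?thesis by simp
qed

lemma GDERIV_unique:
  fixes f :: "'a::real_inner \<Rightarrow> real"
  assumes "GDERIV f x :> D" and "GDERIV f x :> E"
  shows "D = E"
proof -
  have "(\<lambda>h. h \<bullet> D) = (\<lambda>h. h \<bullet> E)"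
    using assms by (auto simp: gderiv_def intro: has_derivative_unique)
  then have "(D - E) \<bullet> D = (D - E) \<bullet> E" by meson
  then have "(D - E) \<bullet> (D - E) = 0" by (simp add: inner_diff_right)
  then show ?thesis by simp
qed

lemma gradient_eqI: "GDERIV f x :> D \<Longrightarrow> gradient f x = D"
  unfolding gradient_def by (blast intro: GDERIV_unique)

text \<open>Riesz representation in finite dimension: the derivative is the inner product with the
  vector of its values on the basis.\<close>
lemma GDERIV_gradient:
  fixes f :: "'a::euclidean_space \<Rightarrow> real"
  assumes "f differentiable (at x)"
  shows "GDERIV f x :> gradient f x"
proof -
  obtain f' where f': "(f has_derivative f') (at x)"
    using assms by (auto simp: differentiable_def)
  then interpret f': bounded_linear f' by (rule has_derivative_bounded_linear)
  have "f' = (\<lambda>h. h \<bullet> (\<Sum>b\<in>Basis. f' b *\<^sub>R b))"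
  proof
    fix h
    have "f' h = f' (\<Sum>b\<in>Basis. (h \<bullet> b) *\<^sub>R b)" by (simp add: euclidean_representation)
    then show "f' h = h \<bullet> (\<Sum>b\<in>Basis. f' b *\<^sub>R b)"
      by (simp add: f'.sum f'.scaleR inner_sum_right mult.commute)
  qed
  with f' have "GDERIV f x :> (\<Sum>b\<in>Basis. f' b *\<^sub>R b)"
    unfolding gderiv_def by simp
  then show ?thesis using gradient_eqI by metis
qed

lemma GDERIV_half_norm_diff_sq:
  "GDERIV (\<lambda>x. 1 / 2 * (norm (x - z))\<^sup>2) x :> x - z"
  unfolding gderiv_def power2_norm_eq_inner
  by (auto intro!: derivative_eq_intros simp: inner_commute)

text \<open>The function \<open>h - \<mu>/2 \<parallel>\<cdot>\<parallel>\<^sup>2\<close> is convex with gradient \<open>\<nabla>h - \<mu> id\<close>; adding its tangent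
  inequalities at the two points shows that this gradient is monotone.\<close>
lemma strongly_convex_gradient_monotone:
  fixes h :: "'a::euclidean_space \<Rightarrow> real"
  assumes "strongly_convex \<mu> h" and diff: "\<And>x. h differentiable (at x)"
  shows "\<mu> * (norm (x - y))\<^sup>2 \<le> (gradient h x - gradient h y) \<bullet> (x - y)"
proof -
  let ?h = "\<lambda>x. h x - \<mu> / 2 * (norm x)\<^sup>2"
  have cvx: "convex_on UNIV ?h" using assms(1) by (simp add: strongly_convex_def)
  have deriv: "GDERIV ?h x :> gradient h x - \<mu> *\<^sub>R x" for x
  proof -
    have "GDERIV (\<lambda>x. \<mu> * (1 / 2 * (norm (x - 0))\<^sup>2)) x :> \<mu> *\<^sub>R (x - 0) + (1 / 2 * (norm (x - 0))\<^sup>2) *\<^sub>R 0"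
      by (intro GDERIV_mult GDERIV_const GDERIV_half_norm_diff_sq)
    then have "GDERIV (\<lambda>x. \<mu> / 2 * (norm x)\<^sup>2) x :> \<mu> *\<^sub>R x" by simp
    then show ?thesis by (intro GDERIV_diff GDERIV_gradient diff)
  qed
  have "(norm (x - y))\<^sup>2 = x \<bullet> (x - y) - y \<bullet> (x - y)"
    by (simp add: power2_norm_eq_inner inner_diff_left)
  then have norm: "\<mu> * (norm (x - y))\<^sup>2 = \<mu> * (x \<bullet> (x - y)) - \<mu> * (y \<bullet> (x - y))"
    by (simp add: right_diff_distrib)
  have "?h x + (gradient h x - \<mu> *\<^sub>R x) \<bullet> (y - x) \<le> ?h y"
    "?h y + (gradient h y - \<mu> *\<^sub>R y) \<bullet> (x - y) \<le> ?h x"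
    using convex_on_above_tangent[OF cvx deriv] by blast+
  moreover have "(gradient h x - \<mu> *\<^sub>R x) \<bullet> (y - x) = - ((gradient h x - \<mu> *\<^sub>R x) \<bullet> (x - y))"
    by (simp add: inner_diff_right)
  ultimately show ?thesis
    using norm by (simp add: inner_diff_left)
qed

section \<open>The proximal operator\<close>

lemma minimizer_ereal_finite:
  fixes g :: "'a::real_inner \<Rightarrow> ereal"
  assumes "closed_convex_proper g" and "c > 0"
    and "is_arg_min (\<lambda>x. ereal c * g x + ereal (h x)) (\<lambda>_. True) x"
  obtains a where "g x = ereal a"
proof -
  obtain y where y: "g y \<noteq> \<infinity>" using assms(1) by (auto simp: closed_convex_proper_def)
  have "g z \<noteq> - \<infinity>" for z using assms(1) by (auto simp: closed_convex_proper_def)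
  then obtain b where b: "g y = ereal b" using y by (metis ereal_cases)
  have "g x \<noteq> \<infinity>"
  proof
    assume "g x = \<infinity>"
    then have "ereal c * g y + ereal (h y) < ereal c * g x + ereal (h x)"
      using b \<open>c > 0\<close> by simp
    then show False using assms(3) by (auto simp: is_arg_min_def)
  qed
  then show ?thesis using \<open>\<And>z. g z \<noteq> - \<infinity>\<close> that by (metis ereal_cases)
qed

text \<open>At a minimizer of \<open>c g + h\<close> the vector \<open>- \<nabla>h / c\<close> is a subgradient of \<open>g\<close>. Moving from \<open>x\<close>
  a fraction \<open>t\<close> towards \<open>y\<close> raises \<open>g\<close> by at most \<open>t (b - a)\<close>, so minimality forces \<open>h\<close> to
  decrease by at most \<open>c\<close> times that. The proof works in the epigraph, where the convexity of the
  extended-valued \<open>g\<close> is ordinary convexity of a set.\<close>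
lemma minimizer_subgradient:
  fixes g :: "'a::real_inner \<Rightarrow> ereal"
  assumes g: "closed_convex_proper g" and c: "c > 0"
    and min: "is_arg_min (\<lambda>x. ereal c * g x + ereal (h x)) (\<lambda>_. True) x"
    and deriv: "GDERIV h x :> D"
    and gx: "g x = ereal a" and gy: "g y = ereal b"
  shows "c * a \<le> c * b + D \<bullet> (y - x)"
proof -
  have "c * (a - b) \<le> D \<bullet> (y - x)"
  proof (rule gderiv_le_of_segment[OF deriv])
    fix t :: real assume t: "0 < t" "t \<le> 1"
    let ?x = "x + t *\<^sub>R (y - x)"
    have "convex (epigraph_ereal g)" using g by (simp add: closed_convex_proper_def)
    moreover have "(x, a) \<in> epigraph_ereal g" "(y, b) \<in> epigraph_ereal g"
      using gx gy by (auto simp: epigraph_ereal_def)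
    ultimately have "(1 - t) *\<^sub>R (x, a) + t *\<^sub>R (y, b) \<in> epigraph_ereal g"
      using t by (intro convexD) auto
    moreover have "(1 - t) *\<^sub>R (x, a) + t *\<^sub>R (y, b) = (?x, (1 - t) * a + t * b)"
      by (simp add: algebra_simps)
    ultimately have le: "g ?x \<le> ereal ((1 - t) * a + t * b)"
      by (simp add: epigraph_ereal_def)
    moreover have "g ?x \<noteq> - \<infinity>" using g by (auto simp: closed_convex_proper_def)
    ultimately obtain r where r: "g ?x = ereal r" by (cases "g ?x") auto
    then have "r \<le> (1 - t) * a + t * b" using le by simp
    then have "c * r \<le> c * ((1 - t) * a + t * b)" using c by simp
    moreover have "c * a + h x \<le> c * r + h ?x"
      using min gx r by (auto simp: is_arg_min_linorder dest: spec[of _ ?x])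
    ultimately show "t * (c * (a - b)) \<le> h ?x - h x" by (simp add: algebra_simps)
  qed
  then show ?thesis by (simp add: algebra_simps)
qed

text \<open>An affine minorant of \<open>g\<close> makes the sublevel sets of \<open>lam r + \<parallel>x - z\<parallel>\<^sup>2 / 2\<close> on the
  epigraph of \<open>g\<close> bounded. As the epigraph is closed, they are compact, and a minimum of this
  continuous function over one of them is a minimum of the proximal objective. The minorant is a
  hypothesis because the minimizer of the composite problem supplies one by first-order
  optimality.\<close>
lemma prox_is_arg_min:
  fixes g :: "'a::euclidean_space \<Rightarrow> ereal"
  assumes g: "closed_convex_proper g" and lam: "lam > 0" and gx: "g x0 = ereal a"
    and minorant: "\<And>y b. g y = ereal b \<Longrightarrow> a \<le> b + D \<bullet> (y - x0)"
  shows "is_arg_min (\<lambda>x. ereal lam * g x + ereal (1 / 2 * (norm (x - z))\<^sup>2)) (\<lambda>_. True)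
           (prox lam g z)"
proof -
  let ?obj = "\<lambda>(x, r). lam * r + 1 / 2 * (norm (x - z))\<^sup>2"
  define m where "m = ?obj (x0, a)"
  define S where "S = epigraph_ereal g \<inter> {s. ?obj s \<le> m}"
  have not_MInf: "g x \<noteq> - \<infinity>" for x using g by (auto simp: closed_convex_proper_def)
  have lower: "a \<le> r + D \<bullet> (x - x0)" if "(x, r) \<in> epigraph_ereal g" for x r
  proof -
    have "g x \<le> ereal r" using that by (simp add: epigraph_ereal_def)
    then obtain b where "g x = ereal b" "b \<le> r" using not_MInf[of x] by (cases "g x") auto
    then show ?thesis using minorant by fastforce
  qed
  have contin: "continuous_on UNIV ?obj"
    by (auto simp: case_prod_beta intro!: continuous_intros)
  have "closed (epigraph_ereal g)" using g by (simp add: closed_convex_proper_def)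
  moreover have "closed {s. ?obj s \<le> m}"
    by (intro closed_Collect_le contin continuous_on_const)
  ultimately have "closed S" unfolding S_def by (rule closed_Int)
  moreover have "bounded S"
  proof -
    \<comment> \<open>Completing the square in the minorant bound confines \<open>x - z\<close> to a ball of radius \<open>sqrt C\<close> around \<open>lam D\<close>.\<close>
    define C where "C = norm (x0 - z) ^ 2 + 2 * lam * (D \<bullet> (z - x0)) + lam\<^sup>2 * (norm D)\<^sup>2"
    define R where "R = norm z + lam * norm D + sqrt C"
    define T where "T = \<bar>m / lam\<bar> + \<bar>a\<bar> + norm D * (R + norm x0)"
    have "(x, r) \<in> cball 0 R \<times> cball 0 T" if "(x, r) \<in> S" for x r
    proof -
      have epi: "(x, r) \<in> epigraph_ereal g" and obj: "lam * r + 1 / 2 * (norm (x - z))\<^sup>2 \<le> m"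
        using that by (auto simp: S_def)
      have "lam * a \<le> lam * (r + D \<bullet> (x - x0))" using lower[OF epi] lam by simp
      moreover have "(norm (x - z - lam *\<^sub>R D))\<^sup>2
          = (norm (x - z))\<^sup>2 - 2 * lam * (D \<bullet> (x - z)) + lam\<^sup>2 * (norm D)\<^sup>2"
        unfolding power2_norm_eq_inner
        by (simp add: inner_diff_left inner_diff_right inner_commute power2_eq_square algebra_simps)
      moreover have "D \<bullet> (x - x0) = D \<bullet> (x - z) + D \<bullet> (z - x0)" by (simp add: inner_diff_right)
      ultimately have "(norm (x - z - lam *\<^sub>R D))\<^sup>2 \<le> C"
        using obj by (simp add: m_def C_def algebra_simps)
      then have "norm (x - z - lam *\<^sub>R D) \<le> sqrt C" using real_le_rsqrt by blast
      moreover have "norm x \<le> norm z + norm (lam *\<^sub>R D) + norm (x - z - lam *\<^sub>R D)"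
        by (smt (verit) norm_triangle_ineq norm_triangle_sub add.commute diff_diff_eq)
      ultimately have x: "norm x \<le> R" using lam by (simp add: R_def)
      have "lam * r \<le> m" using obj by (smt (verit) zero_le_power2 divide_nonneg_pos mult_nonneg_nonneg)
      then have up: "r \<le> m / lam" using lam by (simp add: field_simps)
      have "\<bar>D \<bullet> (x - x0)\<bar> \<le> norm D * norm (x - x0)" by (rule Cauchy_Schwarz_ineq2)
      also have "\<dots> \<le> norm D * (R + norm x0)"
        using x norm_triangle_ineq4[of x x0] by (intro mult_left_mono) auto
      finally have "\<bar>r\<bar> \<le> T" using up lower[OF epi] unfolding T_def by linarith
      then show ?thesis using x by simp
    qed
    then have "S \<subseteq> cball 0 R \<times> cball 0 T" by auto
    then show ?thesis by (rule bounded_subset[rotated]) (intro bounded_Times bounded_cball)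
  qed
  ultimately have "compact S" by (simp add: compact_eq_bounded_closed)
  moreover have "(x0, a) \<in> S" using gx by (auto simp: S_def epigraph_ereal_def m_def)
  ultimately have "\<exists>s\<in>S. \<forall>t\<in>S. ?obj s \<le> ?obj t"
    by (intro continuous_attains_inf continuous_on_subset[OF contin]) auto
  then obtain P r where PS: "(P, r) \<in> S" and in_S: "\<And>y b. (y, b) \<in> S \<Longrightarrow> ?obj (P, r) \<le> ?obj (y, b)"
    by (metis prod.exhaust)
  have best: "?obj (P, r) \<le> ?obj (y, b)" if "g y = ereal b" for y b
  proof (cases "(y, b) \<in> S")
    case False
    then have "m < ?obj (y, b)" using that by (auto simp: S_def epigraph_ereal_def)
    then show ?thesis using PS by (auto simp: S_def)
  qed (rule in_S)
  have "g P \<le> ereal r" using PS by (simp add: S_def epigraph_ereal_def)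
  then have P: "ereal lam * g P + ereal (1 / 2 * (norm (P - z))\<^sup>2) \<le> ereal (?obj (P, r))"
    using not_MInf[of P] lam by (cases "g P") auto
  have "is_arg_min (\<lambda>x. ereal lam * g x + ereal (1 / 2 * (norm (x - z))\<^sup>2)) (\<lambda>_. True) P"
    unfolding is_arg_min_linorder
  proof (intro conjI allI impI TrueI)
    fix y
    show "ereal lam * g P + ereal (1 / 2 * (norm (P - z))\<^sup>2)
        \<le> ereal lam * g y + ereal (1 / 2 * (norm (y - z))\<^sup>2)"
    proof (cases "g y")
      case (real b)
      with best[OF this] P show ?thesis by (auto intro: order_trans)
    next
      case PInf then show ?thesis using lam by simp
    next
      case MInf then show ?thesis using not_MInf by simp
    qed
  qed
  then show ?thesis unfolding prox_def arg_min_def by (rule someI)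
qed

text \<open>The minimizer is a fixed point of the proximal gradient map, and the proximal operator is
  nonexpansive. Adding the subgradient inequalities of \<open>g\<close> at \<open>xstar\<close> and at \<open>prox lam g z\<close>
  cancels the values of \<open>g\<close> and leaves exactly this comparison.\<close>
lemma prox_dist_minimizer_le:
  fixes g :: "'a::euclidean_space \<Rightarrow> ereal"
  assumes g: "closed_convex_proper g" and lam: "lam > 0"
    and min: "is_arg_min (\<lambda>x. g x + ereal (h x)) (\<lambda>_. True) xstar"
    and deriv: "GDERIV h xstar :> D"
  shows "norm (prox lam g z - xstar) \<le> norm (z - (xstar - lam *\<^sub>R D))"
proof -
  define P where "P = prox lam g z"
  have min1: "is_arg_min (\<lambda>x. ereal 1 * g x + ereal (h x)) (\<lambda>_. True) xstar"
    using min by (simp add: one_ereal_def[symmetric])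
  obtain a where a: "g xstar = ereal a"
    using minimizer_ereal_finite[OF g _ min1] by auto
  have star: "a \<le> b + D \<bullet> (y - xstar)" if "g y = ereal b" for y b
    using minimizer_subgradient[OF g _ min1 deriv a that] by simp
  have minP: "is_arg_min (\<lambda>x. ereal lam * g x + ereal (1 / 2 * (norm (x - z))\<^sup>2)) (\<lambda>_. True) P"
    unfolding P_def using prox_is_arg_min[OF g lam a star] .
  obtain b where b: "g P = ereal b" using minimizer_ereal_finite[OF g lam minP] .
  have "lam * b \<le> lam * a + (P - z) \<bullet> (xstar - P)"
    by (rule minimizer_subgradient[OF g lam minP GDERIV_half_norm_diff_sq b a])
  moreover have "lam * a \<le> lam * (b + D \<bullet> (P - xstar))"
    using star[OF b] lam by simp
  moreover have "(P - z) \<bullet> (xstar - P) + lam * (D \<bullet> (P - xstar))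
      = (z - (xstar - lam *\<^sub>R D)) \<bullet> (P - xstar) - (P - xstar) \<bullet> (P - xstar)"
    by (simp add: inner_diff_left inner_diff_right inner_add_left inner_commute algebra_simps)
  ultimately have "(norm (P - xstar))\<^sup>2 \<le> (z - (xstar - lam *\<^sub>R D)) \<bullet> (P - xstar)"
    by (simp add: power2_norm_eq_inner distrib_left)
  also have "\<dots> \<le> norm (z - (xstar - lam *\<^sub>R D)) * norm (P - xstar)"
    by (rule norm_cauchy_schwarz)
  finally show ?thesis
    unfolding P_def[symmetric] by (cases "P = xstar") (auto simp: power2_eq_square)
qed

section \<open>Variances of finite families of vectors\<close>

definition weighted_mean :: "('i \<Rightarrow> real) \<Rightarrow> 'i set \<Rightarrow> ('i \<Rightarrow> 'a::real_inner) \<Rightarrow> 'a" where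
  "weighted_mean p A v = (\<Sum>i\<in>A. p i *\<^sub>R v i)"

definition weighted_variance :: "('i \<Rightarrow> real) \<Rightarrow> 'i set \<Rightarrow> ('i \<Rightarrow> 'a::real_inner) \<Rightarrow> real" where
  "weighted_variance p A v = (\<Sum>i\<in>A. p i * (norm (v i - weighted_mean p A v))\<^sup>2)"

lemma weighted_variance_nonneg:
  "(\<And>i. i \<in> A \<Longrightarrow> 0 \<le> p i) \<Longrightarrow> 0 \<le> weighted_variance p A v"
  by (auto simp: weighted_variance_def intro!: sum_nonneg)

lemma weighted_mean_square_dist:
  fixes v :: "'i \<Rightarrow> 'a::real_inner"
  assumes "sum p A = 1"
  shows "(\<Sum>i\<in>A. p i * (norm (v i - c))\<^sup>2)
    = weighted_variance p A v + (norm (weighted_mean p A v - c))\<^sup>2"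
proof -
  let ?m = "weighted_mean p A v"
  have expand: "(norm (v i - c))\<^sup>2
      = (norm (v i - ?m))\<^sup>2 + 2 * ((v i - ?m) \<bullet> (?m - c)) + (norm (?m - c))\<^sup>2" for i
    unfolding power2_norm_eq_inner
    by (simp add: inner_diff_left inner_diff_right inner_commute algebra_simps)
  have "(\<Sum>i\<in>A. p i * ((v i - ?m) \<bullet> (?m - c))) = (\<Sum>i\<in>A. p i *\<^sub>R (v i - ?m)) \<bullet> (?m - c)"
    by (simp add: inner_sum_left)
  also have "(\<Sum>i\<in>A. p i *\<^sub>R (v i - ?m)) = 0"
    using assms by (simp add: scaleR_diff_right sum_subtractf weighted_mean_def
        flip: scaleR_sum_left)
  finally have cross: "(\<Sum>i\<in>A. p i * ((v i - ?m) \<bullet> (?m - c))) = 0" by simp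
  have "(\<Sum>i\<in>A. p i * (norm (v i - c))\<^sup>2) = weighted_variance p A v
      + 2 * (\<Sum>i\<in>A. p i * ((v i - ?m) \<bullet> (?m - c))) + (\<Sum>i\<in>A. p i) * (norm (?m - c))\<^sup>2"
    unfolding expand weighted_variance_def
    by (simp add: distrib_left sum.distrib sum_distrib_left sum_distrib_right mult.left_commute)
  then show ?thesis using assms cross by simp
qed

lemma weighted_variance_eq_second_moment:
  assumes "sum p A = 1"
  shows "weighted_variance p A v = (\<Sum>i\<in>A. p i * (norm (v i))\<^sup>2) - (norm (weighted_mean p A v))\<^sup>2"
  using weighted_mean_square_dist[OF assms, of v 0] by simp

lemma weighted_mean_scale_diff:
  "weighted_mean p A (\<lambda>i. c *\<^sub>R (u i - v i)) = c *\<^sub>R (weighted_mean p A u - weighted_mean p A v)"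
  by (simp add: weighted_mean_def scaleR_diff_right sum_subtractf scaleR_sum_right mult.commute)

lemma weighted_variance_scale_diff_le:
  fixes u v :: "'i \<Rightarrow> 'a::real_inner"
  assumes "\<And>i. i \<in> A \<Longrightarrow> 0 \<le> p i"
  shows "weighted_variance p A (\<lambda>i. c *\<^sub>R (u i - v i))
    \<le> c\<^sup>2 * (2 * weighted_variance p A u + 2 * weighted_variance p A v)"
proof -
  let ?m = "weighted_mean p A"
  have "(norm (c *\<^sub>R (u i - v i) - ?m (\<lambda>i. c *\<^sub>R (u i - v i))))\<^sup>2
      \<le> c\<^sup>2 * (2 * (norm (u i - ?m u))\<^sup>2 + 2 * (norm (v i - ?m v))\<^sup>2)" for i
  proof -
    have "(norm (c *\<^sub>R (u i - v i) - ?m (\<lambda>i. c *\<^sub>R (u i - v i))))\<^sup>2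
        = c\<^sup>2 * (norm ((u i - ?m u) - (v i - ?m v)))\<^sup>2"
    proof -
      have "c *\<^sub>R (u i - v i) - ?m (\<lambda>i. c *\<^sub>R (u i - v i)) = c *\<^sub>R ((u i - ?m u) - (v i - ?m v))"
        unfolding weighted_mean_scale_diff by (simp add: algebra_simps)
      then show ?thesis by (simp add: power_mult_distrib)
    qed
    moreover have "(norm (a - b))\<^sup>2 \<le> 2 * (norm a)\<^sup>2 + 2 * (norm b)\<^sup>2" for a b :: 'a
    proof -
      have "(norm (a - b))\<^sup>2 + (norm (a + b))\<^sup>2 = 2 * (norm a)\<^sup>2 + 2 * (norm b)\<^sup>2"
        unfolding power2_norm_eq_inner
        by (simp add: inner_diff_left inner_diff_right inner_add_left inner_add_right)
      then show ?thesis by (smt (verit) zero_le_power2)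
    qed
    ultimately show ?thesis by (simp add: mult_left_mono)
  qed
  then have "weighted_variance p A (\<lambda>i. c *\<^sub>R (u i - v i))
      \<le> (\<Sum>i\<in>A. p i * (c\<^sup>2 * (2 * (norm (u i - ?m u))\<^sup>2 + 2 * (norm (v i - ?m v))\<^sup>2)))"
    unfolding weighted_variance_def using assms by (intro sum_mono mult_left_mono)
  also have "\<dots> = c\<^sup>2 * (2 * weighted_variance p A u + 2 * weighted_variance p A v)"
    unfolding weighted_variance_def
    by (simp add: sum_distrib_left sum.distrib algebra_simps)
  finally show ?thesis .
qed

text \<open>The squared error after one step of size \<open>c\<close> along the estimator
  \<open>u i - v i + mean v\<close>, whose mean is \<open>mean u\<close>. Splitting off the mean exactly and
  applying the parallelogram inequality only to the variance of \<open>u - v\<close> leaves \<open>\<parallel>mean u\<parallel>\<^sup>2\<close>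
  with coefficient one. Once the variance of the gradients is bounded, this saving is
  one of the three multiples of \<open>\<mu> / Lb\<close> subtracted in the constant \<open>D_L\<close>.\<close>
lemma weighted_control_variate_le:
  fixes d :: "'a::real_inner"
  assumes p: "\<And>i. i \<in> A \<Longrightarrow> 0 \<le> p i" "sum p A = 1"
  shows "(\<Sum>i\<in>A. p i * (norm (d - c *\<^sub>R (u i - v i + weighted_mean p A v)))\<^sup>2)
    \<le> (norm d)\<^sup>2 - 2 * c * (weighted_mean p A u \<bullet> d)
      + c\<^sup>2 * ((norm (weighted_mean p A u))\<^sup>2
               + 2 * weighted_variance p A u + 2 * weighted_variance p A v)"
proof -
  let ?u = "weighted_mean p A u" and ?v = "weighted_mean p A v"
  have swap: "norm (d - c *\<^sub>R (u i - v i + ?v)) = norm (c *\<^sub>R (u i - v i) - (d - c *\<^sub>R ?v))" for i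
    by (subst norm_minus_commute) (simp add: algebra_simps)
  have "(\<Sum>i\<in>A. p i * (norm (d - c *\<^sub>R (u i - v i + ?v)))\<^sup>2)
      = weighted_variance p A (\<lambda>i. c *\<^sub>R (u i - v i)) + (norm (c *\<^sub>R ?u - d))\<^sup>2"
    unfolding swap weighted_mean_square_dist[OF p(2)] weighted_mean_scale_diff
    by (simp add: algebra_simps)
  also have "(norm (c *\<^sub>R ?u - d))\<^sup>2 = (norm d)\<^sup>2 - 2 * c * (?u \<bullet> d) + c\<^sup>2 * (norm ?u)\<^sup>2"
    unfolding power2_norm_eq_inner
    by (simp add: inner_diff_left inner_diff_right inner_commute power2_eq_square algebra_simps)
  finally show ?thesis
    using weighted_variance_scale_diff_le[of A p c u v] p by (simp add: algebra_simps)
qed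

section \<open>One step of the algorithm\<close>

locale lsvrg_problem =
  fixes n :: nat and f :: "nat \<Rightarrow> 'a::euclidean_space \<Rightarrow> real" and g :: "'a \<Rightarrow> ereal"
    and L :: "nat \<Rightarrow> real" and L\<^sub>F \<mu> :: real and xstar :: 'a
  assumes problem: "problem_properties n f g L L\<^sub>F \<mu>"
    and minimizer: "is_arg_min (\<lambda>x. g x + ereal (finite_sum_avg n f x)) (\<lambda>_. True) xstar"
begin

\<comment> \<open>Keeps \<open>{1..n}\<close> from turning into \<open>{Suc 0..n}\<close> under simplification.\<close>
declare One_nat_def [simp del]

abbreviation "F \<equiv> finite_sum_avg n f"
abbreviation "Lb \<equiv> L_bar n L"
abbreviation "p \<equiv> lipschitz_sampling n L"
abbreviation "mean \<equiv> weighted_mean p {1..n}"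
abbreviation "var \<equiv> weighted_variance p {1..n}"

text \<open>The errors of the dual points, rescaled so that their mean under the sampling is the error
  \<open>(1/n) \<Sum>y\<^sub>i - \<nabla>F(xstar)\<close> of the averaged dual point. The estimator of the algorithm, centred at
  \<open>\<nabla>F(xstar)\<close>, is a difference of two such families plus a mean.\<close>
definition normalized_error :: "(nat \<Rightarrow> 'a) \<Rightarrow> nat \<Rightarrow> 'a" where
  "normalized_error y i = (1 / (n * p i)) *\<^sub>R (y i - gradient (f i) xstar)"

abbreviation "gradients x \<equiv> (\<lambda>i. gradient (f i) x)"

text \<open>The symmetrised Bregman distance of \<open>F\<close> between \<open>x\<close> and the minimizer.\<close>
definition gap :: "'a \<Rightarrow> real" where
  "gap x = (gradient F x - gradient F xstar) \<bullet> (x - xstar)"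

lemma n_pos: "0 < n" and mu_pos: "0 < \<mu>"
  using problem by (auto simp: problem_properties_def strongly_convex_def)

lemma L_pos: "i \<in> {1..n} \<Longrightarrow> 0 < L i"
  using problem by (auto simp: problem_properties_def smooth_def)

lemma sum_L: "(\<Sum>i=1..n. L i) = n * Lb" and Lb_pos: "0 < Lb"
proof -
  show "(\<Sum>i=1..n. L i) = n * Lb" using n_pos by (simp add: L_bar_def)
  have "0 < (\<Sum>i=1..n. L i)" using n_pos L_pos by (intro sum_pos) auto
  then show "0 < Lb" using n_pos by (simp add: L_bar_def)
qed

lemma p_eq: "p i = L i / (n * Lb)"
  by (simp add: lipschitz_sampling_def sum_L)

lemma p_pos: "i \<in> {1..n} \<Longrightarrow> 0 < p i"
  using L_pos Lb_pos n_pos by (simp add: p_eq)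

lemma sum_p: "sum p {1..n} = 1"
  using n_pos Lb_pos sum_L by (simp add: p_eq flip: sum_divide_distrib)

lemma gderiv_f: "i \<in> {1..n} \<Longrightarrow> GDERIV (f i) x :> gradient (f i) x"
  using problem by (auto simp: problem_properties_def smooth_def intro: GDERIV_gradient)

lemma gderiv_F: "GDERIV F x :> gradient F x"
  using problem by (auto simp: problem_properties_def smooth_def intro: GDERIV_gradient)

lemma gradient_F: "gradient F x = (1 / n) *\<^sub>R (\<Sum>i=1..n. gradient (f i) x)"
proof (rule gradient_eqI)
  have "(f i has_derivative (\<lambda>h. h \<bullet> gradient (f i) x)) (at x)" if "i \<in> {1..n}" for i
    using gderiv_f[OF that] by (simp add: gderiv_def)
  then have "((\<lambda>x. 1 / n * (\<Sum>i=1..n. f i x)) has_derivative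
      (\<lambda>h. 1 / n * (\<Sum>i=1..n. h \<bullet> gradient (f i) x))) (at x)"
    by (intro has_derivative_mult_right has_derivative_sum)
  then show "GDERIV F x :> (1 / n) *\<^sub>R (\<Sum>i=1..n. gradient (f i) x)"
    unfolding gderiv_def finite_sum_avg_def by (simp add: inner_sum_right)
qed

lemma mean_normalized_error:
  "mean (normalized_error y) = (1 / n) *\<^sub>R (\<Sum>i=1..n. y i) - gradient F xstar"
proof -
  have "p i *\<^sub>R normalized_error y i = (1 / n) *\<^sub>R (y i - gradient (f i) xstar)" if "i \<in> {1..n}" for i
    using p_pos[OF that] by (simp add: normalized_error_def)
  then have "mean (normalized_error y) = (\<Sum>i=1..n. (1 / n) *\<^sub>R (y i - gradient (f i) xstar))"
    by (simp add: weighted_mean_def)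
  also have "\<dots> = (1 / n) *\<^sub>R (\<Sum>i=1..n. y i) - gradient F xstar"
    by (simp add: gradient_F scaleR_diff_right sum_subtractf scaleR_sum_right)
  finally show ?thesis .
qed

lemma mean_gradients:
  "mean (normalized_error (gradients x)) = gradient F x - gradient F xstar"
  by (simp add: mean_normalized_error gradient_F)

text \<open>Cocoercivity of each \<open>f i\<close> has the constant \<open>1 / L i\<close>, and Lipschitz sampling, with
  \<open>p i\<close> proportional to \<open>L i\<close>, turns all these constants into the same \<open>Lb\<close>, so that the
  bounds add up to the gap of \<open>F\<close>.\<close>
lemma second_moment_gradients_le:
  "(\<Sum>i=1..n. p i * (norm (normalized_error (gradients x) i))\<^sup>2) \<le> Lb * gap x"
proof -
  have "p i * (norm (normalized_error (gradients x) i))\<^sup>2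
      \<le> Lb / n * ((gradient (f i) x - gradient (f i) xstar) \<bullet> (x - xstar))" if i: "i \<in> {1..n}" for i
  proof -
    let ?d = "gradient (f i) x - gradient (f i) xstar"
    have "1 / L i * (norm ?d)\<^sup>2 \<le> ?d \<bullet> (x - xstar)"
      using problem i by (auto simp: problem_properties_def smooth_def)
    then have le: "Lb / n * (1 / L i * (norm ?d)\<^sup>2) \<le> Lb / n * (?d \<bullet> (x - xstar))"
      using Lb_pos by (intro mult_left_mono) auto
    have scale: "norm (normalized_error (gradients x) i) = Lb / L i * norm ?d"
      using L_pos[OF i] Lb_pos n_pos by (simp add: normalized_error_def p_eq)
    have "p i * (norm (normalized_error (gradients x) i))\<^sup>2 = Lb / n * (1 / L i * (norm ?d)\<^sup>2)"
      unfolding scale using L_pos[OF i] Lb_pos n_pos by (simp add: p_eq power2_eq_square field_simps)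
    with le show ?thesis by simp
  qed
  then have "(\<Sum>i=1..n. p i * (norm (normalized_error (gradients x) i))\<^sup>2)
      \<le> (\<Sum>i=1..n. Lb / n * ((gradient (f i) x - gradient (f i) xstar) \<bullet> (x - xstar)))"
    by (rule sum_mono)
  also have "\<dots> = Lb * gap x"
    by (simp add: gap_def gradient_F sum_distrib_left inner_sum_left inner_diff_left
        sum_subtractf right_diff_distrib sum_divide_distrib)
  finally show ?thesis .
qed

lemma gradient_F_monotone:
  "\<mu> * (norm (x - y))\<^sup>2 \<le> (gradient F x - gradient F y) \<bullet> (x - y)"
  using problem by (intro strongly_convex_gradient_monotone)
    (auto simp: problem_properties_def smooth_def)

lemma gap_ge: "\<mu> * (norm (x - xstar))\<^sup>2 \<le> gap x"
  unfolding gap_def by (rule gradient_F_monotone)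

lemma gap_nonneg: "0 \<le> gap x"
  using gap_ge[of x] mu_pos by (smt (verit) mult_nonneg_nonneg zero_le_power2)

lemma mu_inner_le_norm_gradient_diff_sq:
  "\<mu> * ((gradient F x - gradient F y) \<bullet> (x - y)) \<le> (norm (gradient F x - gradient F y))\<^sup>2"
proof -
  let ?D = "norm (gradient F x - gradient F y)" and ?d = "norm (x - y)"
  have CS: "(gradient F x - gradient F y) \<bullet> (x - y) \<le> ?D * ?d" by (rule norm_cauchy_schwarz)
  then have "\<mu> * ?d * ?d \<le> ?D * ?d"
    using gradient_F_monotone[of x y] by (simp add: power2_eq_square)
  then have "\<mu> * ?d \<le> ?D" by (cases "?d = 0") (auto simp: mult_le_cancel_right)
  then have "?D * (\<mu> * ?d) \<le> ?D * ?D" by (intro mult_left_mono) auto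
  moreover have "\<mu> * ((gradient F x - gradient F y) \<bullet> (x - y)) \<le> \<mu> * (?D * ?d)"
    using CS mu_pos by simp
  ultimately show ?thesis by (simp add: power2_eq_square algebra_simps)
qed

text \<open>Cocoercivity and strong convexity of \<open>F\<close> bound the same squared gradient difference from
  above and from below. A basis vector serves as a pair of distinct points.\<close>
lemma mu_le_Lb: "\<mu> \<le> Lb"
proof -
  obtain b :: 'a where b: "b \<in> Basis" using nonempty_Basis by blast
  let ?T = "(gradient F b - gradient F 0) \<bullet> (b - 0)"
  have T: "0 < ?T"
    using gradient_F_monotone[of b 0] b mu_pos by simp
  have LF: "L\<^sub>F > 0" "L\<^sub>F \<le> Lb"
    and "1 / L\<^sub>F * (norm (gradient F b - gradient F 0))\<^sup>2 \<le> ?T"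
    using problem unfolding problem_properties_def smooth_def by blast+
  then have "(norm (gradient F b - gradient F 0))\<^sup>2 \<le> L\<^sub>F * ?T" by (simp add: field_simps)
  then have "\<mu> * ?T \<le> L\<^sub>F * ?T" using mu_inner_le_norm_gradient_diff_sq[of b 0] by linarith
  then show ?thesis using T LF by simp
qed

text \<open>Passing from the second moment to the variance subtracts \<open>\<parallel>\<nabla>F(x) - \<nabla>F(xstar)\<parallel>\<^sup>2\<close>, which
  strong convexity bounds below by \<open>\<mu>\<close> times the gap.\<close>
lemma variance_gradients_le: "var (normalized_error (gradients x)) \<le> (Lb - \<mu>) * gap x"
  using second_moment_gradients_le[of x] mu_inner_le_norm_gradient_diff_sq[of x xstar]
  by (simp add: weighted_variance_eq_second_moment[OF sum_p] mean_gradients gap_def left_diff_distrib)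

lemma expected_primal_step:
  assumes lam: "lam > 0"
  shows "(\<Sum>i=1..n. p i * (norm (fst (lsvrg_step n f g p lam \<eta> i q (x, y)) - xstar))\<^sup>2)
    \<le> (norm (x - xstar))\<^sup>2 - 2 * lam * gap x
      + lam\<^sup>2 * ((2 * Lb - \<mu>) * gap x + 2 * var (normalized_error y))"
proof -
  let ?u = "normalized_error (gradients x)" and ?v = "normalized_error y"
  have g: "closed_convex_proper g" using problem by (simp add: problem_properties_def)
  have "norm (fst (lsvrg_step n f g p lam \<eta> i q (x, y)) - xstar)
      \<le> norm ((x - xstar) - lam *\<^sub>R (?u i - ?v i + mean ?v))" if "i \<in> {1..n}" for i
  proof -
    let ?z = "x - (lam / n) *\<^sub>R ((1 / p i) *\<^sub>R (gradient (f i) x - y i) + (\<Sum>j=1..n. y j))"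
    have shift: "?z - (xstar - lam *\<^sub>R gradient F xstar)
        = (x - xstar) - lam *\<^sub>R (?u i - ?v i + mean ?v)"
      by (simp add: mean_normalized_error normalized_error_def algebra_simps)
    then show ?thesis
      using prox_dist_minimizer_le[OF g lam minimizer gderiv_F, of ?z]
      by (simp only: shift lsvrg_step.simps fst_conv)
  qed
  then have "(\<Sum>i=1..n. p i * (norm (fst (lsvrg_step n f g p lam \<eta> i q (x, y)) - xstar))\<^sup>2)
      \<le> (\<Sum>i=1..n. p i * (norm ((x - xstar) - lam *\<^sub>R (?u i - ?v i + mean ?v)))\<^sup>2)"
    using p_pos by (intro sum_mono mult_left_mono power_mono) (auto simp: less_imp_le)
  also have "\<dots> \<le> (norm (x - xstar))\<^sup>2 - 2 * lam * (mean ?u \<bullet> (x - xstar))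
      + lam\<^sup>2 * ((norm (mean ?u))\<^sup>2 + 2 * var ?u + 2 * var ?v)"
    using p_pos by (intro weighted_control_variate_le sum_p) (auto simp: less_imp_le)
  also have "mean ?u \<bullet> (x - xstar) = gap x"
    by (simp add: mean_gradients gap_def)
  also have "(norm (mean ?u))\<^sup>2 + 2 * var ?u + 2 * var ?v \<le> (2 * Lb - \<mu>) * gap x + 2 * var ?v"
  proof -
    have "(norm (mean ?u))\<^sup>2 + var ?u \<le> Lb * gap x"
      using second_moment_gradients_le[of x]
      by (simp add: weighted_variance_eq_second_moment[OF sum_p])
    then show ?thesis using variance_gradients_le[of x] by (simp add: left_diff_distrib)
  qed
  finally show ?thesis by (simp add: mult_left_mono)
qed

text \<open>The weight of the dual variance must exceed \<open>2 lam\<^sup>2 / \<eta>\<close>, so that refreshing the dual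
  points with probability \<open>\<eta>\<close> pays for the \<open>2 lam\<^sup>2\<close> that the primal step adds. Twice that weight
  leaves a contraction by \<open>1 - \<eta> / 2\<close>.\<close>
definition lyapunov :: "real \<Rightarrow> real \<Rightarrow> 'a \<times> (nat \<Rightarrow> 'a) \<Rightarrow> real" where
  "lyapunov lam \<eta> s = (norm (fst s - xstar))\<^sup>2 + 4 * lam\<^sup>2 / \<eta> * var (normalized_error (snd s))"

lemma norm_sq_le_lyapunov:
  "0 < \<eta> \<Longrightarrow> (norm (fst s - xstar))\<^sup>2 \<le> lyapunov lam \<eta> s"
  using weighted_variance_nonneg[of "{1..n}" p] p_pos
  by (auto simp: lyapunov_def less_imp_le intro!: divide_nonneg_pos mult_nonneg_nonneg)

text \<open>The law of one sample \<open>(i, b)\<close>, where \<open>b\<close> tells whether the dual points are updated.\<close>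
definition coin_sampling :: "real \<Rightarrow> nat \<times> bool \<Rightarrow> real" where
  "coin_sampling \<eta> = (\<lambda>(i, b). p i * (if b then \<eta> else 1 - \<eta>))"

text \<open>A step depends on the uniform sample \<open>q\<close> only through \<open>q < \<eta>\<close>; the values \<open>0\<close> and \<open>\<eta>\<close>
  represent the two outcomes.\<close>
definition coin_step :: "real \<Rightarrow> real \<Rightarrow> nat \<times> bool \<Rightarrow> 'a \<times> (nat \<Rightarrow> 'a) \<Rightarrow> 'a \<times> (nat \<Rightarrow> 'a)" where
  "coin_step lam \<eta> = (\<lambda>(i, b). lsvrg_step n f g p lam \<eta> i (if b then 0 else \<eta>))"

text \<open>The gap appears with coefficient \<open>- lam (2 - lam (6 Lb - 5 \<mu>))\<close>. Since
  \<open>6 Lb - 5 \<mu> \<le> 3/2 (4 Lb - 3 \<mu>)\<close>, the step-size condition makes this at most \<open>- lam / 2\<close>, and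
  strong convexity converts the gap into a decrease of the distance to the minimizer.\<close>
lemma expected_lyapunov_contracts:
  assumes \<eta>: "0 < \<eta>" "\<eta> \<le> 1" and lam: "0 < lam" "lam * (4 * Lb - 3 * \<mu>) \<le> 1"
    and \<rho>: "2 * \<rho> \<le> lam * \<mu>" "2 * \<rho> \<le> \<eta>"
  shows "(\<Sum>c\<in>{1..n} \<times> UNIV. coin_sampling \<eta> c * lyapunov lam \<eta> (coin_step lam \<eta> c s))
    \<le> (1 - \<rho>) * lyapunov lam \<eta> s"
proof -
  obtain x y where s: "s = (x, y)" by (cases s)
  define S where "S = (\<lambda>i. (norm (fst (lsvrg_step n f g p lam \<eta> i \<eta> (x, y)) - xstar))\<^sup>2)"
  define U where "U = var (normalized_error (gradients x))"
  define V where "V = var (normalized_error y)"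
  define d where "d = (norm (x - xstar))\<^sup>2"
  define K where "K = 4 * lam\<^sup>2 / \<eta>"
  have V: "0 \<le> V" using p_pos by (auto simp: V_def less_imp_le intro: weighted_variance_nonneg)
  have step: "lyapunov lam \<eta> (coin_step lam \<eta> (i, b) s) = S i + K * (if b then U else V)" for i b
    using \<eta> by (simp add: lyapunov_def coin_step_def s S_def U_def V_def K_def)
  have "(\<Sum>c\<in>{1..n} \<times> UNIV. coin_sampling \<eta> c * lyapunov lam \<eta> (coin_step lam \<eta> c s))
      = (\<Sum>i=1..n. \<Sum>b\<in>UNIV. coin_sampling \<eta> (i, b) * lyapunov lam \<eta> (coin_step lam \<eta> (i, b) s))"
    by (simp add: sum.cartesian_product)
  also have "\<dots> = (\<Sum>i=1..n. p i * S i + p i * (K * (\<eta> * U + (1 - \<eta>) * V)))"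
    by (intro sum.cong refl) (simp add: UNIV_bool step coin_sampling_def algebra_simps)
  also have "\<dots> = (\<Sum>i=1..n. p i * S i) + K * (\<eta> * U + (1 - \<eta>) * V)"
    using sum_p by (simp add: sum.distrib flip: sum_distrib_right)
  also have "\<dots> \<le> d - 2 * lam * gap x + lam\<^sup>2 * ((2 * Lb - \<mu>) * gap x + 2 * V)
      + K * (\<eta> * ((Lb - \<mu>) * gap x) + (1 - \<eta>) * V)"
    using expected_primal_step[OF lam(1), of \<eta> \<eta> x y] variance_gradients_le[of x] \<eta>
    unfolding S_def U_def V_def d_def K_def
    by (intro add_mono mult_left_mono) auto
  also have "\<dots> = d - lam * gap x * (2 - lam * (6 * Lb - 5 * \<mu>)) + K * ((1 - \<eta> / 2) * V)"
    using \<eta> by (simp add: K_def field_simps power2_eq_square)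
  also have "\<dots> \<le> (1 - \<rho>) * d + K * ((1 - \<rho>) * V)"
  proof (intro add_mono mult_left_mono mult_right_mono)
    have "lam * (6 * Lb - 5 * \<mu>) \<le> lam * (3 / 2 * (4 * Lb - 3 * \<mu>))"
      using lam mu_pos by (intro mult_left_mono) auto
    then have "1 / 2 \<le> 2 - lam * (6 * Lb - 5 * \<mu>)" using lam(2) by linarith
    then have "lam * gap x * (1 / 2) \<le> lam * gap x * (2 - lam * (6 * Lb - 5 * \<mu>))"
      using lam gap_nonneg by (intro mult_left_mono) auto
    moreover have "lam * (\<mu> * d) \<le> lam * gap x"
      using gap_ge[of x] lam by (simp add: d_def)
    moreover have "2 * \<rho> * d \<le> lam * \<mu> * d"
      using \<rho> by (intro mult_right_mono) (auto simp: d_def)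
    ultimately show "d - lam * gap x * (2 - lam * (6 * Lb - 5 * \<mu>)) \<le> (1 - \<rho>) * d"
      by (simp add: algebra_simps)
  qed (use \<eta> \<rho> V in \<open>auto simp: K_def\<close>)
  also have "\<dots> = (1 - \<rho>) * lyapunov lam \<eta> s"
    unfolding lyapunov_def s fst_conv snd_conv d_def[symmetric] V_def[symmetric] K_def[symmetric]
    by (simp add: algebra_simps)
  finally show ?thesis .
qed

end

section \<open>Expectation over the sampled history\<close>

text \<open>The possible values of the samples \<open>(I j, Q j < \<eta>)\<close> for \<open>j < k\<close>. There are finitely many,
  so the iterates are simple random variables. Every real function of them is integrable, and
  its expectation is a finite weighted sum over histories.\<close>
definition histories :: "nat \<Rightarrow> nat \<Rightarrow> (nat \<times> bool) list set" where
  "histories n k = {h. set h \<subseteq> {1..n} \<times> UNIV \<and> length h = k}"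

lemma finite_histories: "finite (histories n k)"
  unfolding histories_def by (intro finite_lists_length_eq) auto

lemma sum_histories_Suc:
  "(\<Sum>h\<in>histories n (Suc k). \<phi> h) = (\<Sum>h\<in>histories n k. \<Sum>c\<in>{1..n} \<times> UNIV. \<phi> (h @ [c]))"
proof -
  have "bij_betw (\<lambda>(h, c). h @ [c]) (histories n k \<times> ({1..n} \<times> UNIV)) (histories n (Suc k))"
  proof (rule bij_betwI[where g = "\<lambda>h. (butlast h, last h)"])
    show "(\<lambda>h. (butlast h, last h)) \<in> histories n (Suc k) \<rightarrow> histories n k \<times> ({1..n} \<times> UNIV)"
    proof
      fix h assume h: "h \<in> histories n (Suc k)"
      then have "h = butlast h @ [last h]" by (cases h rule: rev_cases) (auto simp: histories_def)
      then have "set h = insert (last h) (set (butlast h))"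
        by (metis list.simps(15) rotate1.simps(2) set_rotate1)
      then show "(butlast h, last h) \<in> histories n k \<times> ({1..n} \<times> UNIV)"
        using h by (auto simp: histories_def)
    qed
    show "(\<lambda>(h, c). h @ [c]) (butlast h, last h) = h" if "h \<in> histories n (Suc k)" for h
      using that by (cases h rule: rev_cases) (auto simp: histories_def)
  qed (auto simp: histories_def)
  from sum.reindex_bij_betw[OF this, of \<phi>] show ?thesis
    by (simp add: sum.cartesian_product case_prod_beta)
qed

lemma sample_prob:
  assumes samples: "lsvrg_samples M n p I Q" and i: "i \<in> {1..n}" and \<eta>: "0 < \<eta>" "\<eta> \<le> 1"
  shows "measure M {\<omega> \<in> space M. (I k \<omega>, Q k \<omega> < \<eta>) = (i, b)} = p i * (if b then \<eta> else 1 - \<eta>)"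
proof -
  interpret prob_space M using samples by (simp add: lsvrg_samples_def)
  let ?B = "if b then {..<\<eta>} else {\<eta>..}"
  have Q: "Q k \<in> borel_measurable M"
    \<comment> \<open>The independence hypothesis concerns \<open>I k\<close> viewed as a real-valued variable.\<close>
    and indep: "indep_var (count_space {1..real n}) (\<lambda>\<omega>. real (I k \<omega>)) borel (Q k)"
    and distr: "distr M borel (Q k) = uniform_measure lborel {0..1}"
    and pI: "prob {\<omega> \<in> space M. I k \<omega> = i} = p i"
    using samples i by (auto simp: lsvrg_samples_def)
  have "prob (Q k -` ?B \<inter> space M) = measure (uniform_measure lborel {0..1}) ?B"
    using Q by (simp add: measure_distr flip: distr)
  also have "\<dots> = measure lborel ({0..1} \<inter> ?B)"
    by (subst measure_uniform_measure) auto
  also have "\<dots> = (if b then \<eta> else 1 - \<eta>)"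
  proof (cases b)
    case True
    have "{0..1} \<inter> {..<\<eta>} = {0..<\<eta>}" using \<eta> by auto
    then show ?thesis using True \<eta> by simp
  next
    case False
    have "{0..1} \<inter> {\<eta>..} = {\<eta>..1}" using \<eta> by auto
    then show ?thesis using False \<eta> by simp
  qed
  finally have pQ: "prob (Q k -` ?B \<inter> space M) = (if b then \<eta> else 1 - \<eta>)" .
  have "{\<omega> \<in> space M. (I k \<omega>, Q k \<omega> < \<eta>) = (i, b)}
      = (\<lambda>\<omega>. (real (I k \<omega>), Q k \<omega>)) -` ({real i} \<times> ?B) \<inter> space M" by auto
  also have "prob \<dots> = prob ((\<lambda>\<omega>. real (I k \<omega>)) -` {real i} \<inter> space M) * prob (Q k -` ?B \<inter> space M)"
    using i by (intro indep_varD[OF indep]) auto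
  also have "(\<lambda>\<omega>. real (I k \<omega>)) -` {real i} \<inter> space M = {\<omega> \<in> space M. I k \<omega> = i}" by auto
  finally show ?thesis using pI pQ by simp
qed

lemma sample_in_range:
  assumes "lsvrg_samples M n p I Q" and "\<omega> \<in> space M"
  shows "I k \<omega> \<in> {1..n}"
proof -
  have "I k \<in> M \<rightarrow>\<^sub>M count_space {1..n}" using assms by (auto simp: lsvrg_samples_def)
  from measurable_space[OF this assms(2)] show ?thesis by simp
qed

text \<open>The samples of different iterations are independent, so the probability of a history is a
  product. The empty history is treated separately, because independence speaks of nonempty
  families of events.\<close>
lemma history_prob:
  fixes p :: "nat \<Rightarrow> real"
  assumes samples: "lsvrg_samples M n p I Q" and h: "h \<in> histories n k" and \<eta>: "0 < \<eta>" "\<eta> \<le> 1"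
  shows "{\<omega> \<in> space M. map (\<lambda>j. (I j \<omega>, Q j \<omega> < \<eta>)) [0..<k] = h} \<in> sets M" (is "?E \<in> _")
    and "measure M {\<omega> \<in> space M. map (\<lambda>j. (I j \<omega>, Q j \<omega> < \<eta>)) [0..<k] = h}
      = prod_list (map (\<lambda>(i, b). p i * (if b then \<eta> else 1 - \<eta>)) h)" (is "_ = prod_list (map ?w h)")
proof -
  interpret prob_space M using samples by (simp add: lsvrg_samples_def)
  let ?N = "count_space {1..n} \<Otimes>\<^sub>M (borel :: real measure)"
  let ?X = "\<lambda>j \<omega>. (I j \<omega>, Q j \<omega>)"
  define A where "A j = {fst (h ! j)} \<times> (if snd (h ! j) then {..<\<eta>} else {\<eta>..})" for j
  have indep: "indep_vars (\<lambda>_. ?N) ?X UNIV" using samples by (simp add: lsvrg_samples_def)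
  have len: "length h = k" using h by (simp add: histories_def)
  have range: "fst (h ! j) \<in> {1..n}" if "j < k" for j
  proof -
    have "h ! j \<in> set h" using that len by simp
    then show ?thesis using h by (auto simp: histories_def)
  qed
  have A_sets: "A j \<in> sets ?N" if "j < k" for j
    unfolding A_def using range[OF that] by (intro pair_measureI) auto
  have event: "?X j -` A j \<inter> space M = {\<omega> \<in> space M. (I j \<omega>, Q j \<omega> < \<eta>) = h ! j}" for j
    by (cases "h ! j") (auto simp: A_def)
  have E: "?E = {\<omega> \<in> space M. \<forall>j<k. (I j \<omega>, Q j \<omega> < \<eta>) = h ! j}"
    using len by (auto simp: list_eq_iff_nth_eq)
  show "?E \<in> sets M"
  proof -
    have X: "?X j \<in> M \<rightarrow>\<^sub>M ?N" for j using indep by (simp add: indep_vars_def)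
    show ?thesis
    proof (cases "k = 0")
      case True
      then show ?thesis using len by simp
    next
      case False
      then have "?E = (\<Inter>j\<in>{..<k}. ?X j -` A j \<inter> space M)" unfolding event E by auto
      also have "\<dots> \<in> sets M"
        using False measurable_sets[OF X A_sets] by (intro sets.finite_INT) auto
      finally show ?thesis .
    qed
  qed
  show "prob ?E = prod_list (map ?w h)"
  proof (cases "k = 0")
    case True
    then show ?thesis using len by (simp add: prob_space)
  next
    case False
    then have "?E = (\<Inter>j\<in>{..<k}. ?X j -` A j \<inter> space M)" unfolding event E by auto
    moreover have "prob (\<Inter>j\<in>{..<k}. ?X j -` A j \<inter> space M) = (\<Prod>j<k. prob (?X j -` A j \<inter> space M))"
      using False A_sets by (intro indep_varsD[OF indep]) auto
    ultimately have "prob ?E = (\<Prod>j<k. prob (?X j -` A j \<inter> space M))" by (rule trans[OF arg_cong])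
    also have "\<dots> = (\<Prod>j<k. ?w (h ! j))"
    proof (rule prod.cong[OF refl])
      fix j assume "j \<in> {..<k}"
      then show "prob (?X j -` A j \<inter> space M) = ?w (h ! j)"
        unfolding event using sample_prob[OF samples range \<eta>, of j j "snd (h ! j)"]
        by (simp add: case_prod_beta)
    qed
    also have "\<dots> = prod_list (map ?w h)"
      by (simp add: prod.list_conv_set_nth len atLeast0LessThan)
    finally show ?thesis .
  qed
qed

lemma expectation_history:
  fixes p :: "nat \<Rightarrow> real" and k :: nat and \<phi> :: "(nat \<times> bool) list \<Rightarrow> real"
  assumes samples: "lsvrg_samples M n p I Q" and \<eta>: "0 < \<eta>" "\<eta> \<le> 1"
  defines "H \<equiv> \<lambda>\<omega>. map (\<lambda>j. (I j \<omega>, Q j \<omega> < \<eta>)) [0..<k]"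
  shows "integrable M (\<lambda>\<omega>. \<phi> (H \<omega>))"
    and "(\<integral>\<omega>. \<phi> (H \<omega>) \<partial>M)
      = (\<Sum>h\<in>histories n k. prod_list (map (\<lambda>(i, b). p i * (if b then \<eta> else 1 - \<eta>)) h) * \<phi> h)"
proof -
  interpret prob_space M using samples by (simp add: lsvrg_samples_def)
  let ?E = "\<lambda>h. {\<omega> \<in> space M. H \<omega> = h}"
  let ?s = "\<lambda>\<omega>. \<Sum>h\<in>histories n k. \<phi> h * indicator (?E h) \<omega>"
  have E: "?E h \<in> sets M" if "h \<in> histories n k" for h
    using history_prob(1)[OF samples that \<eta>] by (simp add: H_def)
  have eq: "\<phi> (H \<omega>) = ?s \<omega>" if \<omega>: "\<omega> \<in> space M" for \<omega>
  proof -
    have "H \<omega> \<in> histories n k"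
      using sample_in_range[OF samples \<omega>] by (auto simp: H_def histories_def)
    then have "?s \<omega> = (\<Sum>h\<in>{H \<omega>}. \<phi> h * indicator (?E h) \<omega>)"
      using \<omega> by (intro sum.mono_neutral_right) (auto simp: finite_histories indicator_def)
    then show ?thesis using \<omega> by simp
  qed
  have int: "integrable M (\<lambda>\<omega>. \<phi> h * indicator (?E h) \<omega>)" if "h \<in> histories n k" for h
    using E[OF that] by (intro integrable_mult_right integrable_real_indicator) (auto simp: less_top[symmetric])
  then have "integrable M ?s" by (rule Bochner_Integration.integrable_sum)
  then show "integrable M (\<lambda>\<omega>. \<phi> (H \<omega>))"
    using eq by (subst Bochner_Integration.integrable_cong[of M M _ ?s]) auto
  have "(\<integral>\<omega>. \<phi> (H \<omega>) \<partial>M) = (\<integral>\<omega>. ?s \<omega> \<partial>M)"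
    using eq by (intro Bochner_Integration.integral_cong) auto
  also have "\<dots> = (\<Sum>h\<in>histories n k. \<integral>\<omega>. \<phi> h * indicator (?E h) \<omega> \<partial>M)"
    using int by (rule Bochner_Integration.integral_sum)
  also have "\<dots> = (\<Sum>h\<in>histories n k. \<phi> h * prob (?E h))"
    by (simp add: Int_absorb2)
  also have "\<dots> = (\<Sum>h\<in>histories n k. prod_list (map (\<lambda>(i, b). p i * (if b then \<eta> else 1 - \<eta>)) h) * \<phi> h)"
    using history_prob(2)[OF samples _ \<eta>] by (intro sum.cong) (auto simp: H_def mult.commute)
  finally show "(\<integral>\<omega>. \<phi> (H \<omega>) \<partial>M)
      = (\<Sum>h\<in>histories n k. prod_list (map (\<lambda>(i, b). p i * (if b then \<eta> else 1 - \<eta>)) h) * \<phi> h)" .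
qed

context lsvrg_problem begin

lemma lsvrg_eq_fold:
  assumes "0 < \<eta>"
  shows "lsvrg n f g p lam \<eta> x0 xhat is qs k
    = fold (coin_step lam \<eta>) (map (\<lambda>j. (is j, qs j < \<eta>)) [0..<k]) (x0, \<lambda>i. gradient (f i) xhat)"
proof (induction k)
  case (Suc k)
  have "lsvrg_step n f g p lam \<eta> i q s = coin_step lam \<eta> (i, q < \<eta>) s" for i q s
    using assms by (cases s) (auto simp: coin_step_def)
  then show ?case using Suc by simp
qed simp

text \<open>Appending one sample to a history multiplies its weight by the weight of the sample, so
  the one-step contraction applies conditionally on every history and iterates.\<close>
lemma expected_lyapunov_le:
  fixes x0 xhat :: 'a
  assumes samples: "lsvrg_samples M n p I Q" and \<eta>: "0 < \<eta>" "\<eta> \<le> 1"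
    and lam: "0 < lam" "lam * (4 * Lb - 3 * \<mu>) \<le> 1"
    and \<rho>: "2 * \<rho> \<le> lam * \<mu>" "2 * \<rho> \<le> \<eta>"
  defines "s \<equiv> \<lambda>k \<omega>. lsvrg n f g p lam \<eta> x0 xhat (\<lambda>j. I j \<omega>) (\<lambda>j. Q j \<omega>) k"
  shows "integrable M (\<lambda>\<omega>. (norm (fst (s k \<omega>) - xstar))\<^sup>2)"
    and "(\<integral>\<omega>. (norm (fst (s k \<omega>) - xstar))\<^sup>2 \<partial>M)
      \<le> (1 - \<rho>) ^ k * lyapunov lam \<eta> (x0, gradients xhat)"
proof -
  let ?s0 = "(x0, gradients xhat)"
  let ?run = "\<lambda>h. fold (coin_step lam \<eta>) h ?s0"
  let ?W = "\<lambda>h. prod_list (map (coin_sampling \<eta>) h)"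
  have s: "s k \<omega> = ?run (map (\<lambda>j. (I j \<omega>, Q j \<omega> < \<eta>)) [0..<k])" for k \<omega>
    by (simp add: s_def lsvrg_eq_fold[OF \<eta>(1)])
  have int: "integrable M (\<lambda>\<omega>. \<phi> (s k \<omega>))" for \<phi> :: "_ \<Rightarrow> real" and k
    unfolding s by (rule expectation_history(1)[OF samples \<eta>])
  show "integrable M (\<lambda>\<omega>. (norm (fst (s k \<omega>) - xstar))\<^sup>2)" by (rule int)
  have lyap: "(\<integral>\<omega>. lyapunov lam \<eta> (s k \<omega>) \<partial>M) = (\<Sum>h\<in>histories n k. ?W h * lyapunov lam \<eta> (?run h))" for k
    unfolding s coin_sampling_def by (rule expectation_history(2)[OF samples \<eta>])
  have W: "0 \<le> ?W h" if "h \<in> histories n k" for h k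
  proof (rule prod_list_nonneg)
    fix x assume "x \<in> set (map (coin_sampling \<eta>) h)"
    then obtain i b where "(i, b) \<in> set h" and x: "x = coin_sampling \<eta> (i, b)" by auto
    then have "i \<in> {1..n}" using that by (auto simp: histories_def)
    then show "0 \<le> x" using p_pos[of i] \<eta> by (simp add: x coin_sampling_def)
  qed
  have decay: "(\<Sum>h\<in>histories n k. ?W h * lyapunov lam \<eta> (?run h)) \<le> (1 - \<rho>) ^ k * lyapunov lam \<eta> ?s0"
  proof (induction k)
    case 0
    have "histories n 0 = {[]}" by (auto simp: histories_def)
    then show ?case by simp
  next
    case (Suc k)
    have "(\<Sum>h\<in>histories n (Suc k). ?W h * lyapunov lam \<eta> (?run h))
        = (\<Sum>h\<in>histories n k. ?W h * (\<Sum>c\<in>{1..n} \<times> UNIV.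
            coin_sampling \<eta> c * lyapunov lam \<eta> (coin_step lam \<eta> c (?run h))))"
      by (simp add: sum_histories_Suc sum_distrib_left mult.assoc)
    also have "\<dots> \<le> (\<Sum>h\<in>histories n k. ?W h * ((1 - \<rho>) * lyapunov lam \<eta> (?run h)))"
      using W by (intro sum_mono mult_left_mono expected_lyapunov_contracts \<eta> lam \<rho>)
    also have "\<dots> = (1 - \<rho>) * (\<Sum>h\<in>histories n k. ?W h * lyapunov lam \<eta> (?run h))"
      by (simp add: sum_distrib_left mult.left_commute)
    also have "\<dots> \<le> (1 - \<rho>) * ((1 - \<rho>) ^ k * lyapunov lam \<eta> ?s0)"
      using Suc \<rho> \<eta> by (intro mult_left_mono) auto
    finally show ?case by simp
  qed
  have "(\<integral>\<omega>. (norm (fst (s k \<omega>) - xstar))\<^sup>2 \<partial>M) \<le> (\<integral>\<omega>. lyapunov lam \<eta> (s k \<omega>) \<partial>M)"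
    by (intro integral_mono int norm_sq_le_lyapunov \<eta>)
  with decay lyap[of k]
  show "(\<integral>\<omega>. (norm (fst (s k \<omega>) - xstar))\<^sup>2 \<partial>M) \<le> (1 - \<rho>) ^ k * lyapunov lam \<eta> ?s0"
    by simp
qed

end

section \<open>Complexity\<close>

lemma geometric_decay_le:
  fixes C \<epsilon> \<rho> :: real
  assumes "0 < \<epsilon>" "0 < C" "0 < \<rho>" "\<rho> \<le> 1" and k: "ln (C / \<epsilon>) / \<rho> \<le> real k"
  shows "(1 - \<rho>) ^ k * C \<le> \<epsilon>"
proof -
  have "1 - \<rho> \<le> exp (- \<rho>)" using exp_ge_add_one_self[of "- \<rho>"] by simp
  then have "(1 - \<rho>) ^ k \<le> exp (- \<rho>) ^ k" using assms by (intro power_mono) auto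
  also have "\<dots> = exp (- (\<rho> * k))" by (simp flip: exp_of_nat_mult add: mult.commute)
  also have "\<dots> \<le> exp (- ln (C / \<epsilon>))" using k assms by (simp add: field_simps)
  also have "\<dots> = \<epsilon> / C" using assms by (simp add: exp_minus)
  finally show ?thesis using assms by (simp add: field_simps)
qed

text \<open>Completing the square exhibits the minimum over \<open>\<eta>\<close> and its unique location
  \<open>\<eta> = 1 / sqrt (m a)\<close> at once.\<close>
lemma update_cost_eq:
  fixes a m \<eta> :: real
  assumes "0 < a" "0 < m" "0 < \<eta>"
  shows "(1 + m * \<eta>) * (a + 1 / \<eta>) = (sqrt m + sqrt a)\<^sup>2 + (sqrt (m * a) * \<eta> - 1)\<^sup>2 / \<eta>"
proof -
  have "(sqrt m + sqrt a)\<^sup>2 = m + a + 2 * sqrt (m * a)"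
    using assms by (simp add: power2_sum real_sqrt_mult)
  moreover have "(sqrt (m * a) * \<eta> - 1)\<^sup>2 = m * a * \<eta>\<^sup>2 - 2 * sqrt (m * a) * \<eta> + 1"
    using assms by (simp add: power2_diff power_mult_distrib)
  ultimately show ?thesis using assms by (simp add: field_simps power2_eq_square)
qed

context lsvrg_problem begin

abbreviation "D \<equiv> D_L n L \<mu>"
abbreviation "optimal_frequency \<equiv> sqrt (\<mu> / (real n * D * Lb))"

lemma D_Lb: "D * Lb = 4 * Lb - 3 * \<mu>"
  using Lb_pos by (simp add: D_L_def field_simps)

lemma D_ge_1: "1 \<le> D"
  using Lb_pos mu_le_Lb by (simp add: D_L_def pos_divide_le_eq)

text \<open>With \<open>a = D Lb = 4 Lb - 3 \<mu>\<close> and \<open>b = \<mu> / \<eta>\<close> the step size is \<open>2 / (a + b + r)\<close> for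
  \<open>r = sqrt (a\<^sup>2 + b\<^sup>2)\<close>. The bounds \<open>a \<le> r \<le> a + b\<close> place it between \<open>1 / (a + b)\<close> and \<open>1 / a\<close>.\<close>
lemma step_size_bounds:
  assumes "0 < \<eta>"
  shows "0 < step_size n L \<mu> \<eta>"
    and "step_size n L \<mu> \<eta> * (4 * Lb - 3 * \<mu>) \<le> 1"
    and "1 / (D * (Lb / \<mu>) + 1 / \<eta>) \<le> step_size n L \<mu> \<eta> * \<mu>"
proof -
  define a where "a = D * Lb"
  define b where "b = inverse \<eta> * \<mu>"
  define r where "r = sqrt (a\<^sup>2 + b\<^sup>2)"
  have a: "0 < a" using D_ge_1 Lb_pos by (simp add: a_def)
  have b: "0 < b" using mu_pos assms by (simp add: b_def)
  have step: "step_size n L \<mu> \<eta> = 2 / (a + b + r)"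
    by (simp add: step_size_def a_def b_def r_def)
  have r: "a \<le> r" "r \<le> a + b"
    using a b real_le_rsqrt[of a "a\<^sup>2 + b\<^sup>2"] sqrt_sum_squares_le_sum[of a b] by (auto simp: r_def)
  show "0 < step_size n L \<mu> \<eta>" using a b r by (simp add: step)
  show "step_size n L \<mu> \<eta> * (4 * Lb - 3 * \<mu>) \<le> 1"
    unfolding step D_Lb[symmetric] a_def[symmetric] using a b r by (simp add: field_simps)
  have "D * (Lb / \<mu>) + 1 / \<eta> = (a + b) / \<mu>"
    using mu_pos by (simp add: a_def b_def field_simps)
  then have "1 / (D * (Lb / \<mu>) + 1 / \<eta>) = 1 / (a + b) * \<mu>" by simp
  also have "1 / (a + b) \<le> 2 / (a + b + r)"
    using a b r by (simp add: field_simps)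
  finally show "1 / (D * (Lb / \<mu>) + 1 / \<eta>) \<le> step_size n L \<mu> \<eta> * \<mu>"
    using mu_pos by (simp add: step mult_right_mono)
qed

text \<open>The contraction rate is \<open>\<rho> = 1 / (2 W)\<close>, and \<open>ln (C / \<epsilon>) / \<rho>\<close> iterations suffice for an
  initial Lyapunov value at most \<open>C\<close>. Below the threshold \<open>1 / C\<close> the contribution of \<open>C\<close> to the
  logarithm is at most \<open>ln (1 / \<epsilon>)\<close>, and below \<open>exp (- 1)\<close> the rounding to a whole number of
  iterations is at most \<open>W ln (1 / \<epsilon>)\<close>; this gives at most \<open>5 W ln (1 / \<epsilon>)\<close> iterations.\<close>
lemma complexity_of_frequency:
  assumes \<eta>: "0 < \<eta>" "\<eta> \<le> 1"
  shows "lsvrg_complexity TYPE('w) n f g p (step_size n L \<mu> \<eta>) \<eta> x0 xhat xstar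
    (\<lambda>\<epsilon>. (1 + real n * \<eta>) * (D * (Lb / \<mu>) + 1 / \<eta>) * ln (1 / \<epsilon>))"
proof -
  let ?lam = "step_size n L \<mu> \<eta>"
  define W where "W = D * (Lb / \<mu>) + 1 / \<eta>"
  define \<rho> where "\<rho> = 1 / (2 * W)"
  \<comment> \<open>Adding one keeps \<open>C\<close> positive when the algorithm starts at the optimum, and \<open>ln C\<close> nonnegative.\<close>
  define C where "C = lyapunov ?lam \<eta> (x0, gradients xhat) + 1"
  define \<epsilon>0 where "\<epsilon>0 = min (1 / C) (exp (- 1))"
  have "0 \<le> lyapunov ?lam \<eta> (x0, gradients xhat)"
    using norm_sq_le_lyapunov[OF \<eta>(1)] by (rule order_trans[OF zero_le_power2])
  then have C: "1 \<le> C" by (simp add: C_def)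
  have W: "1 / \<eta> \<le> W" using D_ge_1 Lb_pos mu_pos by (simp add: W_def)
  moreover have "1 \<le> 1 / \<eta>" using \<eta> by simp
  ultimately have W1: "1 \<le> W" by linarith
  have \<rho>: "2 * \<rho> \<le> ?lam * \<mu>" "2 * \<rho> \<le> \<eta>" "0 < \<rho>" "\<rho> \<le> 1"
    using step_size_bounds(3)[OF \<eta>(1), folded W_def] W W1 \<eta> by (simp_all add: \<rho>_def field_simps)
  show ?thesis
    unfolding lsvrg_complexity_def
  proof (intro exI[of _ \<epsilon>0] conjI allI impI)
    show "0 < \<epsilon>0" using C by (simp add: \<epsilon>0_def)
    fix \<epsilon> assume "0 < \<epsilon> \<and> \<epsilon> < \<epsilon>0"
    then have \<epsilon>: "0 < \<epsilon>" "\<epsilon> < 1 / C" "\<epsilon> < exp (- 1)" by (auto simp: \<epsilon>0_def)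
    define K where "K = nat \<lceil>ln (C / \<epsilon>) / \<rho>\<rceil>"
    have "ln \<epsilon> \<le> - 1" using \<epsilon> by (metis less_imp_le ln_exp ln_mono)
    then have ln1: "1 \<le> ln (1 / \<epsilon>)" using \<epsilon> by (simp add: ln_div)
    have "C \<le> 1 / \<epsilon>" using \<epsilon> C by (simp add: field_simps)
    then have "ln C \<le> ln (1 / \<epsilon>)" using C \<epsilon> by (subst ln_le_cancel_iff) auto
    moreover have "ln (C / \<epsilon>) = ln C + ln (1 / \<epsilon>)" using C \<epsilon> by (simp add: ln_div)
    moreover have "0 \<le> ln C" using C by simp
    ultimately have lnC: "ln (C / \<epsilon>) \<le> 2 * ln (1 / \<epsilon>)" and "0 \<le> ln (C / \<epsilon>)"
      using ln1 by linarith+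
    then have "real K \<le> ln (C / \<epsilon>) / \<rho> + 1"
      using \<rho> by (simp add: K_def)
    also have "ln (C / \<epsilon>) / \<rho> = 2 * W * ln (C / \<epsilon>)" by (simp add: \<rho>_def)
    also have "\<dots> \<le> 2 * W * (2 * ln (1 / \<epsilon>))" using lnC W1 by (intro mult_left_mono) auto
    finally have "real K \<le> 4 * (W * ln (1 / \<epsilon>)) + 1" by simp
    moreover have "1 \<le> W * ln (1 / \<epsilon>)" using mult_mono[OF W1 ln1] W1 by simp
    ultimately have K_le: "real K \<le> 5 * (W * ln (1 / \<epsilon>))" by simp
    have "let x = (\<lambda>k \<omega>. fst (lsvrg n f g p ?lam \<eta> x0 xhat (\<lambda>j. I j \<omega>) (\<lambda>j. Q j \<omega>) k)) in
        (\<forall>k\<ge>K. integrable M (\<lambda>\<omega>. (norm (x k \<omega> - xstar))\<^sup>2) \<and>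
          (\<integral>\<omega>. (norm (x k \<omega> - xstar))\<^sup>2 \<partial>M) \<le> \<epsilon>) \<and>
        (\<integral>\<omega>. (\<Sum>k<K. cost k \<omega>) \<partial>M) \<le> O_const * ((1 + real n * \<eta>) * W * ln (1 / \<epsilon>))"
      if samples: "lsvrg_samples M n p I Q" and cost: "iteration_cost M n \<eta> cost"
      for M :: "'w measure" and I Q cost
      unfolding Let_def
    proof (intro conjI allI impI)
      fix k assume "K \<le> k"
      note run = expected_lyapunov_le[OF samples \<eta> step_size_bounds(1,2)[OF \<eta>(1)] \<rho>(1,2), of x0 xhat k]
      show "integrable M (\<lambda>\<omega>. (norm (fst (lsvrg n f g p ?lam \<eta> x0 xhat (\<lambda>j. I j \<omega>) (\<lambda>j. Q j \<omega>) k) - xstar))\<^sup>2)"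
        by (rule run(1))
      have "ln (C / \<epsilon>) / \<rho> \<le> real K" by (simp add: K_def real_nat_ceiling_ge)
      then have "(1 - \<rho>) ^ k * C \<le> \<epsilon>"
        using \<open>K \<le> k\<close> \<epsilon> C \<rho> by (intro geometric_decay_le) auto
      moreover have "(1 - \<rho>) ^ k * lyapunov ?lam \<eta> (x0, gradients xhat) \<le> (1 - \<rho>) ^ k * C"
        using \<rho> by (intro mult_left_mono) (auto simp: C_def)
      ultimately show "(\<integral>\<omega>. (norm (fst (lsvrg n f g p ?lam \<eta> x0 xhat (\<lambda>j. I j \<omega>) (\<lambda>j. Q j \<omega>) k) - xstar))\<^sup>2 \<partial>M) \<le> \<epsilon>"
        using run(2) by linarith
    next
      have "(\<integral>\<omega>. (\<Sum>k<K. cost k \<omega>) \<partial>M) = (\<Sum>k<K. integral\<^sup>L M (cost k))"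
        using cost by (intro Bochner_Integration.integral_sum) (auto simp: iteration_cost_def)
      also have "\<dots> = real K * (1 + real n * \<eta>)" using cost by (simp add: iteration_cost_def)
      also have "\<dots> \<le> 5 * (W * ln (1 / \<epsilon>)) * (1 + real n * \<eta>)"
        using K_le \<eta> by (intro mult_right_mono) auto
      also have "\<dots> = 5 * ((1 + real n * \<eta>) * W * ln (1 / \<epsilon>))" by (simp add: algebra_simps)
      also have "\<dots> \<le> O_const * ((1 + real n * \<eta>) * W * ln (1 / \<epsilon>))"
        using \<eta> W1 ln1 by (intro mult_right_mono) (auto simp: O_const_def)
      finally show "(\<integral>\<omega>. (\<Sum>k<K. cost k \<omega>) \<partial>M) \<le> O_const * ((1 + real n * \<eta>) * W * ln (1 / \<epsilon>))" .
    qed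
    then show "\<exists>K. \<forall>(M :: 'w measure) I Q cost.
          lsvrg_samples M n p I Q \<longrightarrow> iteration_cost M n \<eta> cost \<longrightarrow>
          (let x = (\<lambda>k \<omega>. fst (lsvrg n f g p ?lam \<eta> x0 xhat (\<lambda>j. I j \<omega>) (\<lambda>j. Q j \<omega>) k)) in
           (\<forall>k\<ge>K. integrable M (\<lambda>\<omega>. (norm (x k \<omega> - xstar))\<^sup>2) \<and>
                   (\<integral>\<omega>. (norm (x k \<omega> - xstar))\<^sup>2 \<partial>M) \<le> \<epsilon>) \<and>
           (\<integral>\<omega>. (\<Sum>k<K. cost k \<omega>) \<partial>M)
             \<le> O_const * ((1 + real n * \<eta>) * (D * (Lb / \<mu>) + 1 / \<eta>) * ln (1 / \<epsilon>)))"
      unfolding W_def by blast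
  qed
qed

lemma condition_number_pos: "0 < D * (Lb / \<mu>)"
  using D_ge_1 Lb_pos mu_pos by simp

lemma optimal_frequency_iff:
  assumes "0 < \<eta>"
  shows "sqrt (real n * (D * (Lb / \<mu>))) * \<eta> = 1 \<longleftrightarrow> \<eta> = optimal_frequency"
proof -
  have "optimal_frequency = sqrt (inverse (real n * (D * (Lb / \<mu>))))"
    by (simp add: field_simps)
  also have "\<dots> = inverse (sqrt (real n * (D * (Lb / \<mu>))))" by (rule real_sqrt_inverse)
  finally have eq: "optimal_frequency = inverse (sqrt (real n * (D * (Lb / \<mu>))))" .
  have inverse: "s * \<eta> = 1 \<longleftrightarrow> \<eta> = inverse s" if "0 < s" for s
    using that by (auto simp: field_simps)
  have "0 < sqrt (real n * (D * (Lb / \<mu>)))"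
    using mult_pos_pos[OF _ condition_number_pos, of n] n_pos by simp
  then show ?thesis unfolding eq by (rule inverse)
qed

lemma optimal_frequency_bounds: "0 < optimal_frequency" "optimal_frequency \<le> 1"
proof -
  have pos: "0 < real n * D * Lb" using D_ge_1 Lb_pos n_pos by simp
  then show "0 < optimal_frequency" using mu_pos by simp
  have "1 * 1 * \<mu> \<le> real n * D * Lb"
    using n_pos D_ge_1 mu_le_Lb mu_pos by (intro mult_mono) auto
  then show "optimal_frequency \<le> 1" using pos by simp
qed

lemma cost_factor_eq:
  assumes "0 < \<eta>"
  shows "(1 + real n * \<eta>) * (D * (Lb / \<mu>) + 1 / \<eta>) = (sqrt (real n) + sqrt (D * (Lb / \<mu>)))\<^sup>2
    + (sqrt (real n * (D * (Lb / \<mu>))) * \<eta> - 1)\<^sup>2 / \<eta>"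
  using update_cost_eq[OF condition_number_pos _ assms, of "real n"] n_pos by simp

lemma cost_factor_optimal:
  "(1 + real n * optimal_frequency) * (D * (Lb / \<mu>) + 1 / optimal_frequency)
    = (sqrt (real n) + sqrt (D * (Lb / \<mu>)))\<^sup>2"
  using cost_factor_eq[OF optimal_frequency_bounds(1)]
    optimal_frequency_iff[OF optimal_frequency_bounds(1)] by simp

lemma cost_factor_greater:
  assumes "0 < \<eta>" "\<eta> \<noteq> optimal_frequency"
  shows "(sqrt (real n) + sqrt (D * (Lb / \<mu>)))\<^sup>2 < (1 + real n * \<eta>) * (D * (Lb / \<mu>) + 1 / \<eta>)"
  using cost_factor_eq[OF assms(1)] optimal_frequency_iff[OF assms(1)] assms by simp

lemma optimal_frequency_unique_arg_min:
  assumes "0 < \<epsilon>" "\<epsilon> < 1"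
  shows "is_arg_min (\<lambda>\<eta>. (1 + real n * \<eta>) * (D * (Lb / \<mu>) + 1 / \<eta>) * ln (1 / \<epsilon>))
      (\<lambda>\<eta>. 0 < \<eta> \<and> \<eta> \<le> 1) \<eta> \<longleftrightarrow> \<eta> = optimal_frequency"
proof -
  let ?cost = "\<lambda>\<eta>. (1 + real n * \<eta>) * (D * (Lb / \<mu>) + 1 / \<eta>) * ln (1 / \<epsilon>)"
  have "0 < ln (1 / \<epsilon>)" using assms by (simp add: ln_div)
  then have less: "?cost optimal_frequency < ?cost \<eta>" if "0 < \<eta>" "\<eta> \<noteq> optimal_frequency" for \<eta>
    unfolding cost_factor_optimal using cost_factor_greater[OF that] by (rule mult_strict_right_mono[rotated])
  show ?thesis
  proof
    assume min: "is_arg_min ?cost (\<lambda>\<eta>. 0 < \<eta> \<and> \<eta> \<le> 1) \<eta>"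
    show "\<eta> = optimal_frequency"
    proof (rule ccontr)
      assume "\<eta> \<noteq> optimal_frequency"
      then have "?cost optimal_frequency < ?cost \<eta>" using less min by (simp add: is_arg_min_def)
      then show False
        using min optimal_frequency_bounds unfolding is_arg_min_def by blast
    qed
  next
    assume \<eta>: "\<eta> = optimal_frequency"
    have "?cost optimal_frequency \<le> ?cost \<zeta>" if "0 < \<zeta>" for \<zeta>
      using less[OF that] by (cases "\<zeta> = optimal_frequency") auto
    then show "is_arg_min ?cost (\<lambda>\<eta>. 0 < \<eta> \<and> \<eta> \<le> 1) \<eta>"
      using optimal_frequency_bounds unfolding is_arg_min_linorder \<eta> by blast
  qed
qed

end

theorem corollary6p2:
  fixes f :: "nat \<Rightarrow> 'a::euclidean_space \<Rightarrow> real" and g :: "'a \<Rightarrow> ereal"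
    and L :: "nat \<Rightarrow> real" and L\<^sub>F \<mu> :: real and n :: nat and xstar x0 xhat :: 'a
  assumes "problem_properties n f g L L\<^sub>F \<mu>"
    and "is_arg_min (\<lambda>x. g x + ereal (finite_sum_avg n f x)) (\<lambda>_. True) xstar"
  shows "let D = D_L n L \<mu>; Lb = L_bar n L; p = lipschitz_sampling n L;
             comp = (\<lambda>\<eta> \<epsilon>. (1 + real n * \<eta>) * (D * (Lb / \<mu>) + 1 / \<eta>) * ln (1 / \<epsilon>));
             \<eta>star = sqrt (\<mu> / (real n * D * Lb))
         in (\<forall>\<eta>. 0 < \<eta> \<and> \<eta> \<le> 1 \<longrightarrow>
               lsvrg_complexity TYPE('w) n f g p (step_size n L \<mu> \<eta>) \<eta> x0 xhat xstar (comp \<eta>))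
          \<and> (\<forall>\<epsilon>. 0 < \<epsilon> \<and> \<epsilon> < 1 \<longrightarrow>
               (\<forall>\<eta>. is_arg_min (\<lambda>\<eta>. comp \<eta> \<epsilon>) (\<lambda>\<eta>. 0 < \<eta> \<and> \<eta> \<le> 1) \<eta> \<longleftrightarrow> \<eta> = \<eta>star))
          \<and> lsvrg_complexity TYPE('w) n f g p (step_size n L \<mu> \<eta>star) \<eta>star x0 xhat xstar
               (\<lambda>\<epsilon>. (sqrt (real n) + sqrt (D * (Lb / \<mu>)))\<^sup>2 * ln (1 / \<epsilon>))"
proof -
  interpret lsvrg_problem n f g L L\<^sub>F \<mu> xstar
    using assms by unfold_locales
  show ?thesis
    unfolding Let_def
    using complexity_of_frequency optimal_frequency_unique_arg_min
      complexity_of_frequency[OF optimal_frequency_bounds, unfolded cost_factor_optimal]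
    by blast
qed

end
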